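(* Let $X$ be a Banach space of analytic functions on the unit disc $\mathbb{D}$ such that $\mathcal{O}(\overline{\mathbb{D}})\hookrightarrow X\hookrightarrow \operatorname{Hol}(\mathbb{D})$, both embeddings being continuous. Let $G,g$ be analytic functions in $\mathbb{D}$, and let $\{S_t\}_{t\ge 0}$ be a $C_0$-semigroup on $X$ whose generator $A$ and its domain $\mathcal{D}(A)$ are given by $$Af=G\cdot f'+g\cdot f,\qquad \mathcal{D}(A)=\{f\in X:\ G\cdot f'+g\cdot f\in X\}.$$ Then there exist a holomorphic flow $\Phi=\{\varphi_t\}_{t\ge 0}$ in $\mathbb{D}$ whose infinitesimal generator is $G$, and a cocycle $m$ for $\Phi$ satisfying $$g(z)=\frac{\partial m_t(z)}{\partial t}\Big|_{t=0}\quad (z\in\mathbb{D}),\qquad m_t(z)=\exp\left(\int_0^t g(\varphi_s(z))\,ds\right)\quad (t\ge 0,\ z\in\mathbb{D}),$$ such that $$S_tf(z)=m_t(z)\,f(\varphi_t(z))$$ for every $t\ge 0$, $z\in\mathbb{D}$ and $f\in X$.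
   Context: $\mathbb{D}$ is the open unit disc in $\mathbb{C}$. $\operatorname{Hol}(\mathbb{D})$ is the space of all analytic functions on $\mathbb{D}$ with the topology of uniform convergence on compact subsets. $\mathcal{O}(\overline{\mathbb{D}})$ is the space of functions holomorphic on a neighborhood of the closed disc $\overline{\mathbb{D}}$, with its usual (inductive limit) topology. A $C_0$-semigroup (strongly continuous semigroup) on $X$ is a family $\{T_t\}_{t\ge 0}$ of bounded linear operators on $X$ with $T_0=I$, $T_tT_s=T_{t+s}$ for all $t,s\ge 0$, and $\lim_{t\to 0^+}T_tf=f$ in $X$ for every $f\in X$. Its generator is the operator $Af=\lim_{t\to 0^+}\frac{T_tf-f}{t}$ with domain $\mathcal{D}(A)=\{f\in X:\ \lim_{t\to 0^+}\frac{T_tf-f}{t}\text{ exists in }X\}$. A holomorphic flow in $\mathbb{D}$ is a family $\Phi=\{\varphi_t\}_{t\ge 0}$ of analytic self-maps of $\mathbb{D}$ such that (1) $\varphi_0(z)=z$ for all $z\in\mathbb{D}$; (2) $\varphi_{t+s}(z)=\varphi_t\circ\varphi_s(z)$ for all $t,s\ge 0$, $z\in\mathbb{D}$; (3) $\lim_{t\to s}\varphi_t(z)=\varphi_s(z)$ for all $s\ge 0$, $z\in\mathbb{D}$. The trivial flow $\varphi_t(z)=z$ for all $t$ is allowed. The infinitesimal generator of $\Phi$ is the function $z\mapsto\lim_{t\to 0^+}\frac{\varphi_t(z)-z}{t}$ on $\mathbb{D}$ (this limit always exists, uniformly on compact subsets of $\mathbb{D}$). A (multiplicative) cocycle for a holomorphic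 flow $\Phi$ is a continuous function $m:[0,+\infty)\times\mathbb{D}\to\mathbb{C}$, written $m_t(z)=m(t,z)$, such that (1) $m_t$ is analytic on $\mathbb{D}$ for all $t\ge 0$; (2) $m_0(z)=1$ for all $z\in\mathbb{D}$; (3) $m_{t+s}(z)=m_s(z)\,m_t(\varphi_s(z))$ for all $t,s\ge 0$, $z\in\mathbb{D}$. The derivative $\frac{\partial m_t(z)}{\partial t}|_{t=0}$ is the right derivative at $t=0$. *)

theory Defs
  imports "HOL-Complex_Analysis.Complex_Analysis"
begin

abbreviation unit_disc :: "complex set" where
  "unit_disc \<equiv> ball 0 1"

(* A function on an open set U is represented by its extension by zero to the whole plane. Thus
   equality of functions on U is equality in HOL, and the vector space operations are pointwise. *)

definition zero_ext :: "complex set \<Rightarrow> (complex \<Rightarrow> complex) \<Rightarrow> complex \<Rightarrow> complex" where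
  "zero_ext U f = (\<lambda>z. if z \<in> U then f z else 0)"

definition Hol :: "complex set \<Rightarrow> (complex \<Rightarrow> complex) set" where
  "Hol U = {f. f holomorphic_on U \<and> (\<forall>z. z \<notin> U \<longrightarrow> f z = 0)}"

(* Uniform convergence on compact subsets. On a compact set the pointwise strict bound is the
   bound sup < e for the continuous function h - f. *)

definition Hol_topology :: "complex set \<Rightarrow> (complex \<Rightarrow> complex) topology" where
  "Hol_topology U = topology_generated_by
     {{h \<in> Hol U. \<forall>z\<in>K. cmod (h z - f z) < e} | f K e. f \<in> Hol U \<and> compact K \<and> K \<subseteq> U \<and> e > 0}"

(* A function holomorphic near the closed disc is represented by its restriction to the open
   disc, which determines it near the closed disc. *)

definition Hol_closed_disc :: "(complex \<Rightarrow> complex) set" where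
  "Hol_closed_disc =
     {zero_ext unit_disc h | h U. open U \<and> cball 0 1 \<subseteq> U \<and> h holomorphic_on U}"

definition convex_functions :: "(complex \<Rightarrow> complex) set \<Rightarrow> bool" where
  "convex_functions W \<longleftrightarrow>
     (\<forall>f\<in>W. \<forall>h\<in>W. \<forall>u::real. 0 \<le> u \<and> u \<le> 1 \<longrightarrow>
        (\<lambda>z. complex_of_real (1 - u) * f z + complex_of_real u * h z) \<in> W)"

(* The locally convex inductive limit of the spaces Hol U over the open neighbourhoods U of the
   closed disc. Its convex open sets, which form a base, are exactly the convex sets W whose
   preimage under each restriction map from Hol U is open. (Such preimage conditions are
   translation invariant, because two functions holomorphic on U and V can be added on the
   neighbourhood given by the intersection.) *)

definition Hol_closed_disc_topology :: "(complex \<Rightarrow> complex) topology" where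
  "Hol_closed_disc_topology = topology_generated_by
     {W. W \<subseteq> Hol_closed_disc \<and> convex_functions W \<and>
         (\<forall>U. open U \<and> cball 0 1 \<subseteq> U \<longrightarrow>
            openin (Hol_topology U) {h \<in> Hol U. zero_ext unit_disc h \<in> W})}"

(* Only the values of N on X matter; the value 0 off X makes this a Metric_space on X. *)

definition norm_dist ::
  "(complex \<Rightarrow> complex) set \<Rightarrow> ((complex \<Rightarrow> complex) \<Rightarrow> real) \<Rightarrow>
   (complex \<Rightarrow> complex) \<Rightarrow> (complex \<Rightarrow> complex) \<Rightarrow> real" where
  "norm_dist X N f h = (if f \<in> X \<and> h \<in> X then N (\<lambda>z. f z - h z) else 0)"

definition norm_topology ::
  "(complex \<Rightarrow> complex) set \<Rightarrow> ((complex \<Rightarrow> complex) \<Rightarrow> real) \<Rightarrow> (complex \<Rightarrow> complex) topology" where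
  "norm_topology X N = Metric_space.mtopology X (norm_dist X N)"

definition normed_function_space ::
  "(complex \<Rightarrow> complex) set \<Rightarrow> ((complex \<Rightarrow> complex) \<Rightarrow> real) \<Rightarrow> bool" where
  "normed_function_space X N \<longleftrightarrow>
     (\<lambda>z. 0) \<in> X \<and>
     (\<forall>f\<in>X. \<forall>h\<in>X. (\<lambda>z. f z + h z) \<in> X) \<and>
     (\<forall>c. \<forall>f\<in>X. (\<lambda>z. c * f z) \<in> X) \<and>
     (\<forall>f\<in>X. 0 \<le> N f \<and> (N f = 0 \<longleftrightarrow> f = (\<lambda>z. 0))) \<and>
     (\<forall>c. \<forall>f\<in>X. N (\<lambda>z. c * f z) = cmod c * N f) \<and>
     (\<forall>f\<in>X. \<forall>h\<in>X. N (\<lambda>z. f z + h z) \<le> N f + N h)"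

definition banach_space_of_analytic_functions ::
  "(complex \<Rightarrow> complex) set \<Rightarrow> ((complex \<Rightarrow> complex) \<Rightarrow> real) \<Rightarrow> bool" where
  "banach_space_of_analytic_functions X N \<longleftrightarrow>
     X \<subseteq> Hol unit_disc \<and> normed_function_space X N \<and>
     Metric_space.mcomplete X (norm_dist X N)"

definition bounded_operator ::
  "(complex \<Rightarrow> complex) set \<Rightarrow> ((complex \<Rightarrow> complex) \<Rightarrow> real) \<Rightarrow>
   ((complex \<Rightarrow> complex) \<Rightarrow> complex \<Rightarrow> complex) \<Rightarrow> bool" where
  "bounded_operator X N T \<longleftrightarrow>
     (\<forall>f\<in>X. T f \<in> X) \<and>
     (\<forall>f\<in>X. \<forall>h\<in>X. T (\<lambda>z. f z + h z) = (\<lambda>z. T f z + T h z)) \<and>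
     (\<forall>c. \<forall>f\<in>X. T (\<lambda>z. c * f z) = (\<lambda>z. c * T f z)) \<and>
     (\<exists>C. \<forall>f\<in>X. N (T f) \<le> C * N f)"

definition C0_semigroup ::
  "(complex \<Rightarrow> complex) set \<Rightarrow> ((complex \<Rightarrow> complex) \<Rightarrow> real) \<Rightarrow>
   (real \<Rightarrow> (complex \<Rightarrow> complex) \<Rightarrow> complex \<Rightarrow> complex) \<Rightarrow> bool" where
  "C0_semigroup X N S \<longleftrightarrow>
     (\<forall>t\<ge>0. bounded_operator X N (S t)) \<and>
     (\<forall>f\<in>X. S 0 f = f) \<and>
     (\<forall>t\<ge>0. \<forall>s\<ge>0. \<forall>f\<in>X. S t (S s f) = S (t + s) f) \<and>
     (\<forall>f\<in>X. limitin (norm_topology X N) (\<lambda>t. S t f) f (at_right 0))"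

definition diff_quotient_limit ::
  "(complex \<Rightarrow> complex) set \<Rightarrow> ((complex \<Rightarrow> complex) \<Rightarrow> real) \<Rightarrow>
   (real \<Rightarrow> (complex \<Rightarrow> complex) \<Rightarrow> complex \<Rightarrow> complex) \<Rightarrow>
   (complex \<Rightarrow> complex) \<Rightarrow> (complex \<Rightarrow> complex) \<Rightarrow> bool" where
  "diff_quotient_limit X N S f h \<longleftrightarrow>
     limitin (norm_topology X N) (\<lambda>t z. (S t f z - f z) / complex_of_real t) h (at_right 0)"

definition generator_domain ::
  "(complex \<Rightarrow> complex) set \<Rightarrow> ((complex \<Rightarrow> complex) \<Rightarrow> real) \<Rightarrow>
   (real \<Rightarrow> (complex \<Rightarrow> complex) \<Rightarrow> complex \<Rightarrow> complex) \<Rightarrow> (complex \<Rightarrow> complex) set" where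
  "generator_domain X N S = {f \<in> X. \<exists>h. diff_quotient_limit X N S f h}"

definition generator ::
  "(complex \<Rightarrow> complex) set \<Rightarrow> ((complex \<Rightarrow> complex) \<Rightarrow> real) \<Rightarrow>
   (real \<Rightarrow> (complex \<Rightarrow> complex) \<Rightarrow> complex \<Rightarrow> complex) \<Rightarrow>
   (complex \<Rightarrow> complex) \<Rightarrow> complex \<Rightarrow> complex" where
  "generator X N S f = (THE h. diff_quotient_limit X N S f h)"

definition first_order_expr ::
  "(complex \<Rightarrow> complex) \<Rightarrow> (complex \<Rightarrow> complex) \<Rightarrow> (complex \<Rightarrow> complex) \<Rightarrow> complex \<Rightarrow> complex" where
  "first_order_expr G g f = zero_ext unit_disc (\<lambda>z. G z * deriv f z + g z * f z)"

definition holomorphic_flow :: "(real \<Rightarrow> complex \<Rightarrow> complex) \<Rightarrow> bool" where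
  "holomorphic_flow \<phi> \<longleftrightarrow>
     (\<forall>t\<ge>0. \<phi> t holomorphic_on unit_disc \<and> \<phi> t ` unit_disc \<subseteq> unit_disc) \<and>
     (\<forall>z\<in>unit_disc. \<phi> 0 z = z) \<and>
     (\<forall>t\<ge>0. \<forall>s\<ge>0. \<forall>z\<in>unit_disc. \<phi> (t + s) z = \<phi> t (\<phi> s z)) \<and>
     (\<forall>s\<ge>0. \<forall>z\<in>unit_disc. ((\<lambda>t. \<phi> t z) \<longlongrightarrow> \<phi> s z) (at s within {0..}))"

definition infinitesimal_generator ::
  "(real \<Rightarrow> complex \<Rightarrow> complex) \<Rightarrow> (complex \<Rightarrow> complex) \<Rightarrow> bool" where
  "infinitesimal_generator \<phi> G \<longleftrightarrow>
     (\<forall>z\<in>unit_disc. ((\<lambda>t. (\<phi> t z - z) / complex_of_real t) \<longlongrightarrow> G z) (at_right 0))"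

definition cocycle ::
  "(real \<Rightarrow> complex \<Rightarrow> complex) \<Rightarrow> (real \<Rightarrow> complex \<Rightarrow> complex) \<Rightarrow> bool" where
  "cocycle \<phi> m \<longleftrightarrow>
     continuous_on ({0..} \<times> unit_disc) (\<lambda>(t, z). m t z) \<and>
     (\<forall>t\<ge>0. m t holomorphic_on unit_disc) \<and>
     (\<forall>z\<in>unit_disc. m 0 z = 1) \<and>
     (\<forall>t\<ge>0. \<forall>s\<ge>0. \<forall>z\<in>unit_disc. m (t + s) z = m s z * m t (\<phi> s z))"

end

theory Submission
  imports Defs
begin

text \<open>
  The generator says that \<open>u(t,z) = S t f z\<close> solves the first order equation
  \<open>u\<^sub>t = G u\<^sub>z + g u\<close> with initial value \<open>f\<close>. Along a characteristic, a solution of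
  \<open>\<zeta>' = G(\<zeta>)\<close> starting at \<open>z\<close>, such a function is transported, which yields
  \<open>S t f z = exp (\<integral>\<^sub>0\<^sup>t g(\<zeta>)) f(\<zeta> t)\<close> for as long as \<open>\<zeta>\<close> stays in the disc. This is the required
  formula; what has to be shown is that no characteristic ever leaves the disc.

  An arbitrary \<open>f\<close> need not lie in the domain of the generator, so the transport argument is applied to the
  integrated orbit \<open>V t = \<integral>\<^sub>0\<^sup>t S s f ds\<close>. It lies in the domain, and the generator maps it to \<open>S t f - f\<close>;
  read pointwise, this is an inhomogeneous first order equation for \<open>V\<close>
  (\<open>integrated_equation\<close>), which is solved along characteristics (\<open>integrated_characteristic\<close>) and
  then differentiated in \<open>t\<close> (\<open>characteristic_formula\<close>). The integral is a limit of Riemann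
  sums in the norm of \<open>X\<close>; for them to converge, the orbit has to be continuous from both sides, and
  this follows from the local boundedness of the semigroup, an instance of Baire's theorem
  (\<open>locally_bounded\<close>).

  For global existence, choose \<open>\<delta>\<close> such that all characteristics from the disc of radius 1/2 survive up to
  time \<open>\<delta>\<close>. For \<open>t \<le> \<delta>\<close> the functions \<open>c\<^sub>k = S t (z^k)\<close> satisfy \<open>c\<^sub>k c\<^sub>0^(k-1) = c\<^sub>1^k\<close> on that smaller disc,
  hence on the whole unit disc. Continuity of the embedding of the functions holomorphic
  near the closed disc makes the norm of \<open>z^k\<close>, and therefore \<open>c\<^sub>k(z)\<close>, grow at most like \<open>R^k\<close> for
  every \<open>R > 1\<close>. This forces \<open>\<bar>c\<^sub>1\<bar> \<le> \<bar>c\<^sub>0\<bar>\<close>, so that \<open>c\<^sub>1 = c\<^sub>0 F\<close> with a holomorphic self-map \<open>F\<close> of the disc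
  (\<open>composition_symbol_from_powers\<close>). By the Schwarz-Pick inequality, \<open>F\<close> maps a disc of radius
  \<open>r < 1\<close> into a compact subset of the unit disc that does not depend on \<open>t \<le> \<delta>\<close>, because \<open>F 0\<close> runs through a
  compact set (\<open>flow_stays_in_compact\<close>). Wherever a characteristic is defined it agrees with \<open>F\<close>, so it can be
  continued up to time \<open>\<delta>\<close> from every starting point, and then for all times (\<open>lives_forever\<close>).
\<close>

section \<open>The autonomous differential equation\<close>

definition ode_solution :: "(complex \<Rightarrow> complex) \<Rightarrow> complex set \<Rightarrow> (real \<Rightarrow> complex) \<Rightarrow> real \<Rightarrow> bool" where
  "ode_solution G D \<zeta> T \<longleftrightarrow>
     (\<forall>t\<in>{0..T}. \<zeta> t \<in> D \<and> (\<zeta> has_vector_derivative G (\<zeta> t)) (at t within {0..T}))"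

text \<open>
  Picard iteration: the integral operator contracts the complete space of continuous curves with values in the
  ball. The length of the time interval enters only through \<open>M * \<delta>\<close> and \<open>L * \<delta>\<close>, which is what
  makes existence times uniform on compact sets.
\<close>

lemma picard_local_solution:
  fixes G :: "complex \<Rightarrow> complex"
  assumes "0 < \<epsilon>" and "0 < \<delta>"
    and cont: "continuous_on (cball z \<epsilon>) G"
    and bound: "\<And>w. w \<in> cball z \<epsilon> \<Longrightarrow> norm (G w) \<le> M"
    and lips: "\<And>v w. v \<in> cball z \<epsilon> \<Longrightarrow> w \<in> cball z \<epsilon> \<Longrightarrow> norm (G v - G w) \<le> L * norm (v - w)"
    and "M * \<delta> \<le> \<epsilon>" and "L * \<delta> \<le> 1 / 2"
  obtains \<zeta> where "\<zeta> 0 = z" "ode_solution G (cball z \<epsilon>) \<zeta> \<delta>"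
proof -
  define S where "S = {f :: real \<Rightarrow>\<^sub>C complex. \<forall>t. apply_bcontfun f t \<in> cball z \<epsilon>}"
  (* Curves on the time interval are extended constantly to the whole line, so that the
    library's complete metric space of bounded continuous functions can be used. *)
  define clamp where "clamp t = max 0 (min \<delta> t)" for t :: real
  define Q where "Q f t = z + integral {0..clamp t} (\<lambda>s. G (apply_bcontfun f s))" for f t
  have clamp: "clamp t \<in> {0..\<delta>}" for t
    using \<open>0 < \<delta>\<close> by (auto simp: clamp_def)
  have M: "0 \<le> M"
    using bound[of z] \<open>0 < \<epsilon>\<close> by (meson centre_in_cball dual_order.trans less_eq_real_def norm_ge_zero)
  have L: "0 \<le> L"
  proof -
    have "0 \<le> L * norm ((z + of_real \<epsilon>) - z)"
      by (rule order_trans[OF _ lips]) (use \<open>0 < \<epsilon>\<close> in \<open>auto simp: dist_norm\<close>)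
    then show ?thesis using \<open>0 < \<epsilon>\<close> by (simp add: zero_le_mult_iff)
  qed
  have contG: "continuous_on A (\<lambda>s. G (apply_bcontfun f s))" if "f \<in> S" for f A
    by (rule continuous_on_compose2[OF cont]) (use that in \<open>auto simp: S_def intro!: continuous_intros\<close>)
  have int: "(\<lambda>s. G (apply_bcontfun f s)) integrable_on {a..b}" if "f \<in> S" for f a b
    by (rule integrable_continuous_interval) (rule contG[OF that])
  have Qball: "Q f t \<in> cball z \<epsilon>" if "f \<in> S" for f t
  proof -
    have "norm (integral {0..clamp t} (\<lambda>s. G (apply_bcontfun f s))) \<le> M * (clamp t - 0)"
      using clamp[of t] that by (intro integral_bound contG) (auto simp: S_def intro!: bound)
    also have "\<dots> \<le> M * \<delta>"
      using clamp[of t] M by (intro mult_left_mono) auto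
    finally show ?thesis
      using \<open>M * \<delta> \<le> \<epsilon>\<close> by (simp add: Q_def dist_norm)
  qed
  have Qcont: "continuous_on UNIV (Q f)" if "f \<in> S" for f
  proof -
    have "continuous_on {0..\<delta>} (\<lambda>x. integral {0..x} (\<lambda>s. G (apply_bcontfun f s)))"
      by (rule indefinite_integral_continuous_1[OF int[OF that]])
    then have "continuous_on UNIV (\<lambda>t. integral {0..clamp t} (\<lambda>s. G (apply_bcontfun f s)))"
      by (rule continuous_on_compose2) (use clamp in \<open>auto simp: clamp_def intro!: continuous_intros\<close>)
    then show ?thesis
      unfolding Q_def by (intro continuous_intros)
  qed
  have Qb: "Q f \<in> bcontfun" if "f \<in> S" for f
    unfolding bcontfun_def
    using Qcont[OF that] Qball[OF that] by (auto simp: image_subset_iff intro!: bounded_subset[OF bounded_cball])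
  define P where "P f = Bcontfun (Q f)" for f
  have P: "apply_bcontfun (P f) t = Q f t" if "f \<in> S" for f t
    using Qb[OF that] by (simp add: P_def Bcontfun_inverse)
  have "S = PiC UNIV (\<lambda>_. cball z \<epsilon>)"
    by (auto simp: S_def mem_PiC_iff Pi_iff)
  then have "closed S"
    by (simp add: closed_PiC)
  then have "complete S"
    by (simp add: complete_eq_closed)
  moreover have "const_bcontfun z \<in> S"
    using \<open>0 < \<epsilon>\<close> by (auto simp: S_def)
  moreover have "P ` S \<subseteq> S"
    using P Qball by (auto simp: S_def)
  moreover have "dist (P f) (P h) \<le> 1 / 2 * dist f h" if "f \<in> S" "h \<in> S" for f h
  proof (rule dist_bound)
    fix t
    have "norm (integral {0..clamp t} (\<lambda>s. G (apply_bcontfun f s) - G (apply_bcontfun h s)))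
        \<le> (L * dist f h) * (clamp t - 0)"
    proof (rule integral_bound)
      fix s
      have "norm (G (apply_bcontfun f s) - G (apply_bcontfun h s)) \<le> L * dist (apply_bcontfun f s) (apply_bcontfun h s)"
        using lips that by (auto simp: S_def dist_norm)
      also have "\<dots> \<le> L * dist f h"
        by (intro mult_left_mono dist_bounded L)
      finally show "norm (G (apply_bcontfun f s) - G (apply_bcontfun h s)) \<le> L * dist f h" .
    qed (use clamp[of t] that in \<open>auto intro!: continuous_intros contG\<close>)
    also have "\<dots> \<le> (L * dist f h) * \<delta>"
      using clamp[of t] L by (intro mult_left_mono) auto
    also have "\<dots> = (L * \<delta>) * dist f h" by simp
    also have "\<dots> \<le> 1 / 2 * dist f h"
      using \<open>L * \<delta> \<le> 1 / 2\<close> by (intro mult_right_mono) auto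
    finally show "dist (apply_bcontfun (P f) t) (apply_bcontfun (P h) t) \<le> 1 / 2 * dist f h"
      using that by (simp add: P Q_def dist_norm integral_diff[OF int int])
  qed
  ultimately have "\<exists>!f\<in>S. P f = f"
    by (intro Banach_fix[where c = "1/2"]) auto
  then obtain f where f: "f \<in> S" "P f = f"
    by blast
  have feq: "apply_bcontfun f t = z + integral {0..clamp t} (\<lambda>s. G (apply_bcontfun f s))" for t
    using P[OF f(1), of t] f(2) by (simp add: Q_def)
  show ?thesis
  proof
    show "apply_bcontfun f 0 = z"
      using feq[of 0] \<open>0 < \<delta>\<close> by (simp add: clamp_def)
    show "ode_solution G (cball z \<epsilon>) (apply_bcontfun f) \<delta>"
      unfolding ode_solution_def
    proof (intro ballI conjI)
      fix t assume t: "t \<in> {0..\<delta>}"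
      show "apply_bcontfun f t \<in> cball z \<epsilon>" using f(1) by (simp add: S_def)
      from t have "((\<lambda>t. z + integral {0..t} (\<lambda>s. G (apply_bcontfun f s)))
          has_vector_derivative 0 + G (apply_bcontfun f t)) (at t within {0..\<delta>})"
        by (intro has_vector_derivative_add has_vector_derivative_const integral_has_vector_derivative contG f)
      then have "((\<lambda>t. z + integral {0..t} (\<lambda>s. G (apply_bcontfun f s)))
          has_vector_derivative G (apply_bcontfun f t)) (at t within {0..\<delta>})"
        by simp
      then show "(apply_bcontfun f has_vector_derivative G (apply_bcontfun f t)) (at t within {0..\<delta>})"
      proof (rule has_vector_derivative_transform[rotated 2])
        show "apply_bcontfun f s = z + integral {0..s} (\<lambda>s. G (apply_bcontfun f s))" if "s \<in> {0..\<delta>}" for s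
          using feq[of s] that by (simp add: clamp_def)
      qed (rule t)
    qed
  qed
qed

text \<open>
  A compact subset of \<open>D\<close> has a compact neighbourhood in \<open>D\<close>; bounds for \<open>G\<close> and its derivative there
  serve all starting points at once.
\<close>

lemma ode_uniform_local_existence:
  assumes "open D" "G holomorphic_on D" "compact K" "K \<subseteq> D"
  obtains \<delta> where "0 < \<delta>" "\<And>z. z \<in> K \<Longrightarrow> \<exists>\<zeta>. \<zeta> 0 = z \<and> ode_solution G D \<zeta> \<delta>"
proof -
  obtain e where e: "0 < e" "(\<Union>x\<in>K. cball x e) \<subseteq> D"
    using compact_subset_open_imp_cball_epsilon_subset[OF assms(3,1,4)] by blast
  define K' where "K' = (\<Union>x\<in>K. cball x e)"
  have K': "compact K'" "K' \<subseteq> D"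
    unfolding K'_def using e compact_minkowski_sum_cball[OF \<open>compact K\<close>] by auto
  have "continuous_on K' G" "continuous_on K' (deriv G)"
    using assms K' by (auto intro!: holomorphic_on_imp_continuous_on holomorphic_deriv holomorphic_on_subset[OF _ K'(2)])
  then have "bounded (G ` K')" "bounded (deriv G ` K')"
    using K' compact_continuous_image compact_imp_bounded by blast+
  then obtain M L where M: "0 < M" "\<And>w. w \<in> K' \<Longrightarrow> norm (G w) \<le> M"
      and L: "0 < L" "\<And>w. w \<in> K' \<Longrightarrow> norm (deriv G w) \<le> L"
    by (auto simp: bounded_pos)
  define \<delta> where "\<delta> = min (e / M) (1 / (2 * L))"
  have \<delta>: "0 < \<delta>" "M * \<delta> \<le> e" "L * \<delta> \<le> 1 / 2"
    unfolding \<delta>_def using M(1) L(1) e(1)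
      mult_left_mono[OF min.cobounded1[of "e / M" "1 / (2 * L)"], of M]
      mult_left_mono[OF min.cobounded2[of "e / M" "1 / (2 * L)"], of L] by simp_all
  show ?thesis
  proof (rule that[OF \<delta>(1)])
    fix z assume z: "z \<in> K"
    have sub: "cball z e \<subseteq> K'" using z by (auto simp: K'_def)
    obtain \<zeta> where "\<zeta> 0 = z" "ode_solution G (cball z e) \<zeta> \<delta>"
    proof (rule picard_local_solution[OF e(1) \<delta>(1), where G=G and M=M and L=L and z=z])
      show "continuous_on (cball z e) G"
        using \<open>continuous_on K' G\<close> sub continuous_on_subset by blast
      show "norm (G v - G w) \<le> L * norm (v - w)" if "v \<in> cball z e" "w \<in> cball z e" for v w
      proof (rule field_differentiable_bound[where f' = "deriv G"])
        fix x assume "x \<in> cball z e"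
        then have "x \<in> D" using sub K' by auto
        then show "(G has_field_derivative deriv G x) (at x within cball z e)"
          using assms by (simp add: holomorphic_derivI)
      qed (use that sub L in auto)
    qed (use sub M \<delta> in auto)
    moreover have "cball z e \<subseteq> D" using sub K' by blast
    ultimately show "\<exists>\<zeta>. \<zeta> 0 = z \<and> ode_solution G D \<zeta> \<delta>"
      unfolding ode_solution_def by blast
  qed
qed

lemma ode_solution_subinterval:
  assumes "ode_solution G D \<zeta> T" "S \<le> T"
  shows "ode_solution G D \<zeta> S"
  unfolding ode_solution_def
proof (intro ballI conjI)
  fix t assume t: "t \<in> {0..S}"
  with assms have T: "t \<in> {0..T}" by auto
  then show "\<zeta> t \<in> D" using assms by (auto simp: ode_solution_def)
  show "(\<zeta> has_vector_derivative G (\<zeta> t)) (at t within {0..S})"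
    by (rule has_vector_derivative_within_subset[of _ _ _ "{0..T}"])
       (use assms T in \<open>auto simp: ode_solution_def\<close>)
qed

lemma ode_solution_concat:
  assumes 1: "ode_solution G D \<zeta> a" and 2: "ode_solution G D \<eta> b"
    and "0 \<le> a" "0 \<le> b" and eq: "\<eta> 0 = \<zeta> a"
  shows "ode_solution G D (\<lambda>t. if t \<in> {0..a} then \<zeta> t else \<eta> (t - a)) (a + b)"
  unfolding ode_solution_def
proof (intro ballI conjI)
  fix t assume t: "t \<in> {0..a + b}"
  show "(if t \<in> {0..a} then \<zeta> t else \<eta> (t - a)) \<in> D"
    using 1 2 t by (auto simp: ode_solution_def)
  have d2: "((\<lambda>t. \<eta> (t - a)) has_vector_derivative G (\<eta> (t - a))) (at t within {a..a+b})" if "t \<in> {a..a+b}"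
  proof -
    have "(\<eta> has_vector_derivative G (\<eta> (t - a))) (at (t - a) within {0..b})"
      using 2 that by (auto simp: ode_solution_def)
    moreover have "(\<lambda>t. t - a) ` {a..a+b} = {0..b}"
      by (auto simp: image_iff intro: bexI[of _ "_ + a"])
    ultimately have "(\<eta> \<circ> (\<lambda>t. t - a) has_vector_derivative 1 *\<^sub>R G (\<eta> (t - a))) (at t within {a..a+b})"
      by (intro vector_diff_chain_within) (auto intro!: derivative_eq_intros simp: has_vector_derivative_def)
    then show ?thesis by (simp add: o_def)
  qed
  have "((\<lambda>t. if t \<in> {0..a} then \<zeta> t else \<eta> (t - a)) has_vector_derivative
      (if t \<in> {0..a} then G (\<zeta> t) else G (\<eta> (t - a)))) (at t within {0..a+b})"
    by (rule has_vector_derivative_If_within_closures[where T = "{a..a+b}"])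
       (use t 1 d2 assms in \<open>auto simp: insert_absorb ode_solution_def\<close>)
  then show "((\<lambda>t. if t \<in> {0..a} then \<zeta> t else \<eta> (t - a)) has_vector_derivative
      G (if t \<in> {0..a} then \<zeta> t else \<eta> (t - a))) (at t within {0..a+b})"
    by (simp add: if_distrib)
qed

lemma ode_solution_cong:
  assumes "ode_solution G D \<zeta> T" "\<And>t. t \<in> {0..T} \<Longrightarrow> \<eta> t = \<zeta> t"
  shows "ode_solution G D \<eta> T"
  unfolding ode_solution_def
proof (intro ballI conjI)
  fix t assume t: "t \<in> {0..T}"
  show "\<eta> t \<in> D" using assms t by (simp add: ode_solution_def)
  have "(\<zeta> has_vector_derivative G (\<eta> t)) (at t within {0..T})"
    using assms t by (simp add: ode_solution_def)
  then show "(\<eta> has_vector_derivative G (\<eta> t)) (at t within {0..T})"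
    by (rule has_vector_derivative_transform[OF t, rotated]) (rule assms(2))
qed

lemma ode_solution_continuous: "ode_solution G D \<zeta> T \<Longrightarrow> continuous_on {0..T} \<zeta>"
  unfolding ode_solution_def continuous_on_eq_continuous_within
  by (blast intro: has_vector_derivative_continuous)

section \<open>Recognising a composition symbol from the images of the powers\<close>

text \<open>
  Where \<open>b\<close> does not vanish the quotient is bounded by 1, and the zeros of \<open>b\<close> are isolated, so they are removable
  singularities of the quotient.
\<close>

lemma holomorphic_dominated_quotient:
  assumes "open D" "connected D" and a: "a holomorphic_on D" and b: "b holomorphic_on D"
    and le: "\<And>z. z \<in> D \<Longrightarrow> cmod (a z) \<le> cmod (b z)"
    and nz: "\<beta> \<in> D" "b \<beta> \<noteq> 0"
  obtains F where "F holomorphic_on D" "\<And>z. z \<in> D \<Longrightarrow> a z = b z * F z"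
    "\<And>z. z \<in> D \<Longrightarrow> cmod (F z) \<le> 1"
proof -
  (* The quotient extends holomorphically near each point; taking limits glues these extensions. *)
  have loc: "\<exists>r h. 0 < r \<and> ball \<xi> r \<subseteq> D \<and> h holomorphic_on ball \<xi> r \<and>
      (\<forall>z\<in>ball \<xi> r - {\<xi>}. b z \<noteq> 0 \<and> h z = a z / b z)" if \<xi>: "\<xi> \<in> D" for \<xi>
  proof -
    have "\<exists>r>0. ball \<xi> r \<subseteq> D \<and> (\<forall>z\<in>ball \<xi> r - {\<xi>}. b z \<noteq> 0)"
    proof (cases "b \<xi> = 0")
      case True
      then show ?thesis
        using isolated_zeros[OF b assms(1,2) \<xi> True nz] by metis
    next
      case False
      have "continuous_on D b" using b holomorphic_on_imp_continuous_on by blast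
      then have "open (D \<inter> b -` (- {0}))"
        using \<open>open D\<close> continuous_open_preimage by blast
      moreover have "\<xi> \<in> D \<inter> b -` (- {0})" using False \<xi> by simp
      ultimately obtain r where "0 < r" "ball \<xi> r \<subseteq> D \<inter> b -` (- {0})"
        by (rule openE)
      then show ?thesis by (intro exI[of _ r]) auto
    qed
    then obtain r where r: "0 < r" "ball \<xi> r \<subseteq> D" "\<And>z. z \<in> ball \<xi> r - {\<xi>} \<Longrightarrow> b z \<noteq> 0"
      by blast
    have "(\<lambda>z. a z / b z) holomorphic_on ball \<xi> r - {\<xi>}"
      using r by (intro holomorphic_intros holomorphic_on_subset[OF a] holomorphic_on_subset[OF b]) auto
    moreover have "eventually (\<lambda>z. cmod (a z / b z) \<le> 1) (at \<xi>)"
    proof -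
      have "eventually (\<lambda>z. z \<in> ball \<xi> r - {\<xi>}) (at \<xi>)"
        using r(1) by (intro eventually_at_in_open) auto
      then show ?thesis
      proof eventually_elim
        case (elim z)
        then show ?case using le[of z] r(2) r(3)[of z] by (auto simp: norm_divide divide_simps)
      qed
    qed
    ultimately obtain h where "h holomorphic_on ball \<xi> r" "\<forall>z\<in>ball \<xi> r - {\<xi>}. h z = a z / b z"
      using holomorphic_on_extend_bounded[of "\<lambda>z. a z / b z" "ball \<xi> r" \<xi>] r(1)
      unfolding interior_ball centre_in_ball by blast
    then show ?thesis using r by blast
  qed
  define F where "F \<xi> = Lim (at \<xi>) (\<lambda>z. a z / b z)" for \<xi>
  have key: "F holomorphic_on ball \<xi> r \<and> a \<xi> = b \<xi> * F \<xi> \<and> cmod (F \<xi>) \<le> 1"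
    if \<xi>: "\<xi> \<in> D" and r: "0 < r" "ball \<xi> r \<subseteq> D" and h: "h holomorphic_on ball \<xi> r"
      and bz: "\<And>z. z \<in> ball \<xi> r - {\<xi>} \<Longrightarrow> b z \<noteq> 0 \<and> h z = a z / b z" for \<xi> r h
  proof -
    have conth: "isCont h w" if "w \<in> ball \<xi> r" for w
      using that h by (metis holomorphic_on_imp_continuous_on continuous_on_eq_continuous_at open_ball)
    have Fh: "F w = h w" if w: "w \<in> ball \<xi> r" for w
      unfolding F_def
    proof (rule tendsto_Lim)
      have "eventually (\<lambda>z. z \<in> ball \<xi> r - {w}) (at w)" "eventually (\<lambda>z. z \<noteq> \<xi>) (at w)"
        using w by (intro eventually_at_in_open eventually_neq_at_within; simp)+
      then have "eventually (\<lambda>z. h z = a z / b z) (at w)"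
        by eventually_elim (use bz in auto)
      then show "((\<lambda>z. a z / b z) \<longlongrightarrow> h w) (at w)"
        using conth[OF w] unfolding isCont_def by (rule Lim_transform_eventually[rotated])
    qed auto
    have "\<xi> \<in> ball \<xi> r" using r by simp
    have ev: "eventually (\<lambda>z. z \<in> ball \<xi> r - {\<xi>}) (at \<xi>)"
      using r(1) by (intro eventually_at_in_open) auto
    have lim: "(h \<longlongrightarrow> h \<xi>) (at \<xi>)" "(a \<longlongrightarrow> a \<xi>) (at \<xi>)" "(b \<longlongrightarrow> b \<xi>) (at \<xi>)"
      using conth[of \<xi>] r(1) a b \<xi> \<open>open D\<close>
      by (auto simp: isCont_def holomorphic_on_imp_continuous_on continuous_on_eq_continuous_at
               dest!: holomorphic_on_imp_continuous_on)
    have "((\<lambda>z. b z * h z) \<longlongrightarrow> a \<xi>) (at \<xi>)"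
      using lim(2) by (rule Lim_transform_eventually) (use ev in eventually_elim, use bz in auto)
    then have "a \<xi> = b \<xi> * h \<xi>"
      using tendsto_unique[OF _ _ tendsto_mult[OF lim(3,1)]] by auto
    moreover have "cmod (h \<xi>) \<le> 1"
    proof (rule tendsto_upperbound[OF tendsto_norm[OF lim(1)]])
      show "eventually (\<lambda>z. cmod (h z) \<le> 1) (at \<xi>)"
        using ev
      proof eventually_elim
        case (elim z)
        then have "cmod (a z) \<le> cmod (b z)" using r(2) le by blast
        moreover have "b z \<noteq> 0" "h z = a z / b z" using bz[OF elim] by auto
        ultimately show ?case by (simp add: norm_divide divide_le_eq)
      qed
    qed auto
    moreover have "F holomorphic_on ball \<xi> r"
      using h Fh by (metis holomorphic_cong)
    ultimately show ?thesis using Fh[OF \<open>\<xi> \<in> ball \<xi> r\<close>] by simp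
  qed
  have "F holomorphic_on D"
  proof -
    have "F analytic_on {\<xi>}" if "\<xi> \<in> D" for \<xi>
    proof -
      from loc[OF that] obtain r h where r: "0 < r" "ball \<xi> r \<subseteq> D" "h holomorphic_on ball \<xi> r"
        "\<forall>z\<in>ball \<xi> r - {\<xi>}. b z \<noteq> 0 \<and> h z = a z / b z" by blast
      have "F holomorphic_on ball \<xi> r" using key[OF that r(1,2,3)] r(4) by blast
      then show ?thesis using r(1) unfolding analytic_at_ball by blast
    qed
    then show ?thesis
      by (meson analytic_imp_holomorphic analytic_on_analytic_at)
  qed
  moreover have "a z = b z * F z \<and> cmod (F z) \<le> 1" if "z \<in> D" for z
    using loc[OF that] key[OF that] by metis
  ultimately show ?thesis using that by blast
qed

lemma Moebius_defect_identity:
  fixes w f :: complex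
  shows "(cmod (1 - cnj w * f))\<^sup>2 - (cmod (f - w))\<^sup>2 = (1 - (cmod w)\<^sup>2) * (1 - (cmod f)\<^sup>2)"
  unfolding cmod_power2 by (simp add: algebra_simps power2_eq_square)

text \<open>
  After composition with the Moebius map that sends \<open>F 0\<close> to 0, the Schwarz lemma controls the pseudohyperbolic
  distance of \<open>F z\<close> and \<open>F 0\<close>. The bound is not sharp, but it is smaller than 1 and depends only on
  \<open>q\<close> and \<open>r\<close>.
\<close>

lemma Schwarz_Pick_bound:
  assumes F: "F holomorphic_on ball 0 1" "F ` ball 0 1 \<subseteq> ball 0 1"
    and q: "cmod (F 0) \<le> q" "q < 1" and r: "cmod z \<le> r" "r < 1"
  shows "(cmod (F z))\<^sup>2 \<le> 1 - (1 - r\<^sup>2) * (1 - q)\<^sup>2"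
proof -
  define w where "w = F 0"
  define h where "h = Moebius_function 0 w \<circ> F"
  have w: "cmod w < 1" using q by (simp add: w_def)
  have Fz: "cmod (F u) < 1" if "cmod u < 1" for u
    using F(2) that by (auto simp: image_subset_iff)
  have "h holomorphic_on ball 0 1"
    unfolding h_def by (rule holomorphic_on_compose_gen[OF F(1) Moebius_function_holomorphic[OF w] F(2)])
  moreover have "h 0 = 0" by (simp add: h_def w_def Moebius_function_eq_zero)
  moreover have "cmod (h u) < 1" if "cmod u < 1" for u
    using Moebius_function_norm_lt_1[OF w Fz[OF that]] by (simp add: h_def)
  ultimately have "cmod (h z) \<le> cmod z"
    using Schwarz_Lemma(1)[of h z] r by auto
  then have hz: "cmod (h z) \<le> r" using r by simp
  define d where "d = cmod (1 - cnj w * F z)"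
  have "cmod (cnj w * F z) \<le> q * 1"
    unfolding norm_mult using q Fz[of z] r order_trans[OF norm_ge_zero q(1)]
    by (intro mult_mono) (auto simp: w_def)
  then have d: "1 - q \<le> d"
    using norm_triangle_ineq2[of 1 "cnj w * F z"] by (simp add: d_def)
  then have "0 < d" using q by simp
  have "cmod (F z - w) = cmod (h z) * d"
    using \<open>0 < d\<close> by (simp add: h_def Moebius_function_simple d_def norm_divide)
  also have "\<dots> \<le> r * d" using hz \<open>0 < d\<close> by simp
  finally have "(cmod (F z - w))\<^sup>2 \<le> (r * d)\<^sup>2" by (simp add: power_mono)
  then have "(1 - r\<^sup>2) * d\<^sup>2 \<le> (1 - (cmod w)\<^sup>2) * (1 - (cmod (F z))\<^sup>2)"
    using Moebius_defect_identity[of w "F z"] by (simp add: d_def algebra_simps power_mult_distrib)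
  also have "\<dots> \<le> 1 * (1 - (cmod (F z))\<^sup>2)"
    using Fz[of z] r by (intro mult_right_mono) (auto simp: abs_square_le_1)
  finally have "(1 - r\<^sup>2) * d\<^sup>2 \<le> 1 - (cmod (F z))\<^sup>2" by simp
  moreover have "(1 - r\<^sup>2) * (1 - q)\<^sup>2 \<le> (1 - r\<^sup>2) * d\<^sup>2"
    using d q r norm_ge_zero[of z]
    by (intro mult_left_mono power_mono) (auto simp: abs_square_le_1 simp del: norm_ge_zero)
  ultimately show ?thesis by simp
qed

lemma le_one_of_subexponential_powers:
  fixes x A :: real
  assumes "0 < A" and growth: "\<And>R. 1 < R \<Longrightarrow> \<exists>C. \<forall>k. A * x ^ k \<le> C * R ^ k"
  shows "x \<le> 1"
proof (rule ccontr)
  assume "\<not> x \<le> 1"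
  then have x: "1 < x" by simp
  define R where "R = (1 + x) / 2"
  have R: "1 < R" "R < x" using x by (auto simp: R_def)
  obtain C where C: "\<And>k. A * x ^ k \<le> C * R ^ k" using growth[OF R(1)] by blast
  obtain k where k: "C / A < (x / R) ^ k"
    using real_arch_pow[of "x / R" "C / A"] R by auto
  have "A * x ^ k / R ^ k \<le> C" using C[of k] R by (simp add: divide_le_eq)
  then show False using k R \<open>0 < A\<close> by (simp add: power_divide divide_simps mult.commute)
qed

text \<open>
  The identity theorem spreads \<open>c k = c 0 * p^k\<close>, written without quotients, from \<open>U\<close> to the whole disc. If
  \<open>\<bar>c 1 z\<bar>\<close> were larger than \<open>\<bar>c 0 z\<bar>\<close> at some \<open>z\<close>, the sequence \<open>c k z\<close> would grow
  exponentially with a rate above 1, against the growth condition. The maximum principle excludes that the symbol takes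
  values of modulus 1, because it does not do so at 0.
\<close>

lemma composition_symbol_from_powers:
  assumes U: "open U" "U \<subseteq> ball 0 1" "0 \<in> U"
    and hol: "\<And>k. c k holomorphic_on ball 0 1"
    and onU: "\<And>k z. z \<in> U \<Longrightarrow> c k z = c 0 z * p z ^ k"
    and nz: "c 0 0 \<noteq> 0" and p0: "cmod (p 0) < 1"
    and growth: "\<And>R z. 1 < R \<Longrightarrow> z \<in> ball 0 1 \<Longrightarrow> \<exists>C. \<forall>k. cmod (c k z) \<le> C * R ^ k"
  obtains F where "F holomorphic_on ball 0 1" "F ` ball 0 1 \<subseteq> ball 0 1"
    "\<And>z. z \<in> ball 0 1 \<Longrightarrow> c 1 z = c 0 z * F z"
proof -
  have id: "c (Suc k) z * c 0 z ^ k = c 1 z ^ Suc k" if z: "z \<in> ball 0 1" for k z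
  proof (rule analytic_continuation_open[where s = U and s' = "ball 0 1" and z = z
        and f = "\<lambda>z. c (Suc k) z * c 0 z ^ k" and g = "\<lambda>z. c 1 z ^ Suc k"])
    show "c (Suc k) w * c 0 w ^ k = c 1 w ^ Suc k" if "w \<in> U" for w
      using onU[OF that, of "Suc k"] onU[OF that, of 1] by (simp add: power_mult_distrib)
  qed (use U z in \<open>auto intro!: holomorphic_intros hol\<close>)
  have le: "cmod (c 1 z) \<le> cmod (c 0 z)" if z: "z \<in> ball 0 1" for z
  proof (cases "c 0 z = 0")
    case True
    then show ?thesis using id[OF z, of 1] by simp
  next
    case False
    have *: "c k z = c 0 z * (c 1 z / c 0 z) ^ k" for k
    proof (cases k)
      case (Suc j)
      then show ?thesis using id[OF z, of j] False by (simp add: power_divide field_simps)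
    qed simp
    have "cmod (c 1 z / c 0 z) \<le> 1"
    proof (rule le_one_of_subexponential_powers)
      fix R :: real assume "1 < R"
      then obtain C where C: "\<And>k. cmod (c k z) \<le> C * R ^ k" using growth[OF _ z] by blast
      have "cmod (c 0 z) * cmod (c 1 z / c 0 z) ^ k \<le> C * R ^ k" for k
        using C[of k] unfolding *[of k] norm_mult norm_power by simp
      then show "\<exists>C. \<forall>k. cmod (c 0 z) * cmod (c 1 z / c 0 z) ^ k \<le> C * R ^ k" by blast
    qed (use False in simp)
    then show ?thesis using False by (simp add: norm_divide)
  qed
  obtain F where F: "F holomorphic_on ball 0 1" "\<And>z. z \<in> ball 0 1 \<Longrightarrow> c 1 z = c 0 z * F z"
    "\<And>z. z \<in> ball 0 1 \<Longrightarrow> cmod (F z) \<le> 1"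
    by (rule holomorphic_dominated_quotient[OF open_ball connected_ball hol hol le _ nz]) auto
  have F0: "cmod (F 0) < 1"
    using F(2)[of 0] onU[OF U(3), of 1] nz p0 by simp
  have "cmod (F w) < 1" if w: "w \<in> ball 0 1" for w
  proof (rule ccontr)
    assume "\<not> cmod (F w) < 1"
    then have w1: "cmod (F w) = 1" using F(3)[OF w] by simp
    have "F constant_on ball 0 1"
      by (rule maximum_modulus_principle[OF F(1), of "ball 0 1" w]) (use w w1 F(3) in auto)
    then have "F w = F 0" using w unfolding constant_on_def by auto
    then show False using w1 F0 by simp
  qed
  then have "F ` ball 0 1 \<subseteq> ball 0 1" by auto
  then show ?thesis using that[OF F(1) _ F(2)] by blast
qed

section \<open>Banach spaces of analytic functions\<close>

lemma zero_in_Hol: "(\<lambda>z. 0) \<in> Hol U"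
  by (auto simp: Hol_def)

text \<open>
  The topology is given by a subbase whose members are centred at arbitrary functions; by compactness, such a set
  contains a smaller one centred at 0 as soon as it contains 0.
\<close>

lemma zero_neighbourhood_Hol:
  assumes "openin (Hol_topology U) P" "(\<lambda>z. 0) \<in> P"
  obtains K e where "compact K" "K \<subseteq> U" "0 < e"
    "\<And>h. h \<in> Hol U \<Longrightarrow> (\<And>z. z \<in> K \<Longrightarrow> cmod (h z) < e) \<Longrightarrow> h \<in> P"
proof -
  have "\<exists>K e. compact K \<and> K \<subseteq> U \<and> 0 < e \<and> (\<forall>h\<in>Hol U. (\<forall>z\<in>K. cmod (h z) < e) \<longrightarrow> h \<in> P)"
    using openin_topology_generated_by[OF assms(1)[unfolded Hol_topology_def]] assms(2)
  proof induction
    case Empty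
    then show ?case by simp
  next
    case (Int a b)
    then obtain K e K' e' where "compact K" "K \<subseteq> U" "0 < e" "\<forall>h\<in>Hol U. (\<forall>z\<in>K. cmod (h z) < e) \<longrightarrow> h \<in> a"
      "compact K'" "K' \<subseteq> U" "0 < e'" "\<forall>h\<in>Hol U. (\<forall>z\<in>K'. cmod (h z) < e') \<longrightarrow> h \<in> b"
      by auto
    then show ?case
      by (intro exI[of _ "K \<union> K'"] exI[of _ "min e e'"]) auto
  next
    case (UN \<K>)
    then show ?case by (meson UnionE UnionI)
  next
    case (Basis s)
    then obtain f K e where f: "f \<in> Hol U" "compact K" "K \<subseteq> U" "0 < e"
      and s: "s = {h \<in> Hol U. \<forall>z\<in>K. cmod (h z - f z) < e}"
      by auto
    have lt: "cmod (f z) < e" if "z \<in> K" for z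
      using Basis(2) that by (auto simp: s)
    show ?case
    proof (cases "K = {}")
      case True
      then show ?thesis using f s by (intro exI[of _ "{}"] exI[of _ 1]) auto
    next
      case False
      have "continuous_on K (\<lambda>z. cmod (f z))"
        using f by (auto simp: Hol_def intro!: continuous_intros holomorphic_on_imp_continuous_on
              intro: holomorphic_on_subset)
      then obtain z0 where z0: "z0 \<in> K" "\<And>z. z \<in> K \<Longrightarrow> cmod (f z) \<le> cmod (f z0)"
        using continuous_attains_sup[OF f(2) False] by blast
      have "h \<in> s" if "h \<in> Hol U" "\<forall>z\<in>K. cmod (h z) < e - cmod (f z0)" for h
        unfolding s
      proof (intro CollectI conjI ballI that)
        fix z assume "z \<in> K"
        then show "cmod (h z - f z) < e"
          using norm_triangle_ineq4[of "h z" "f z"] that(2) z0(2)[of z] by force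
      qed
      then show ?thesis
        using f lt[OF z0(1)] by (intro exI[of _ K] exI[of _ "e - cmod (f z0)"]) auto
    qed
  qed
  then obtain K e where "compact K" "K \<subseteq> U" "0 < e"
    "\<forall>h\<in>Hol U. (\<forall>z\<in>K. cmod (h z) < e) \<longrightarrow> h \<in> P"
    by (elim exE conjE)
  then show ?thesis by (intro that) auto
qed

lemma Hol_small_open:
  assumes "compact K" "K \<subseteq> U" "0 < e"
  shows "openin (Hol_topology U) {h \<in> Hol U. \<forall>z\<in>K. cmod (h z) < e}"
  unfolding Hol_topology_def
proof (rule topology_generated_by_Basis, intro CollectI exI conjI)
  show "{h \<in> Hol U. \<forall>z\<in>K. cmod (h z) < e} = {h \<in> Hol U. \<forall>z\<in>K. cmod (h z - (\<lambda>z. 0) z) < e}"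
    by simp
qed (use assms zero_in_Hol in auto)

lemma topspace_Hol: "topspace (Hol_topology U) = Hol U"
proof -
  have "openin (Hol_topology U) (Hol U)"
    using Hol_small_open[of "{}" U 1] by simp
  then show ?thesis
    unfolding Hol_topology_def topology_generated_by_topspace
    by (auto dest!: openin_subset)
qed

text \<open>
  This is the defining property of the inductive limit. It reduces a statement about functions near
  the closed disc to a single Frechet space of functions holomorphic on a larger disc.
\<close>

lemma zero_ext_restriction_continuous:
  assumes U: "open U" "cball 0 1 \<subseteq> U"
  shows "continuous_map (Hol_topology U) Hol_closed_disc_topology (zero_ext unit_disc)"
  unfolding Hol_closed_disc_topology_def
proof (rule continuous_on_generated_topo)
  let ?B = "{W. W \<subseteq> Hol_closed_disc \<and> convex_functions W \<and>
         (\<forall>U. open U \<and> cball 0 1 \<subseteq> U \<longrightarrow>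
            openin (Hol_topology U) {h \<in> Hol U. zero_ext unit_disc h \<in> W})}"
  fix W assume "W \<in> ?B"
  then have "openin (Hol_topology U) {h \<in> Hol U. zero_ext unit_disc h \<in> W}" using U by blast
  moreover have "zero_ext unit_disc -` W \<inter> topspace (Hol_topology U) = {h \<in> Hol U. zero_ext unit_disc h \<in> W}"
    by (auto simp: topspace_Hol)
  ultimately show "openin (Hol_topology U) (zero_ext unit_disc -` W \<inter> topspace (Hol_topology U))"
    by simp
next
  let ?B = "{W. W \<subseteq> Hol_closed_disc \<and> convex_functions W \<and>
         (\<forall>U. open U \<and> cball 0 1 \<subseteq> U \<longrightarrow>
            openin (Hol_topology U) {h \<in> Hol U. zero_ext unit_disc h \<in> W})}"
  have in_closed: "zero_ext unit_disc h \<in> Hol_closed_disc" if "h \<in> Hol V" "open V" "cball 0 1 \<subseteq> V" for h V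
    using that by (auto simp: Hol_closed_disc_def Hol_def)
  have "convex_functions Hol_closed_disc"
    unfolding convex_functions_def
  proof (intro ballI allI impI)
    fix f h and u :: real assume "f \<in> Hol_closed_disc" "h \<in> Hol_closed_disc"
    then obtain f' h' V W where "open V" "cball 0 1 \<subseteq> V" "f' holomorphic_on V" "f = zero_ext unit_disc f'"
      "open W" "cball 0 1 \<subseteq> W" "h' holomorphic_on W" "h = zero_ext unit_disc h'"
      unfolding Hol_closed_disc_def by blast
    then have "open (V \<inter> W)" "cball 0 1 \<subseteq> V \<inter> W"
      "(\<lambda>z. complex_of_real (1 - u) * f' z + complex_of_real u * h' z) holomorphic_on V \<inter> W"
      "(\<lambda>z. complex_of_real (1 - u) * f z + complex_of_real u * h z) =
       zero_ext unit_disc (\<lambda>z. complex_of_real (1 - u) * f' z + complex_of_real u * h' z)"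
      by (auto simp: zero_ext_def fun_eq_iff intro!: holomorphic_intros intro: holomorphic_on_subset)
    then show "(\<lambda>z. complex_of_real (1 - u) * f z + complex_of_real u * h z) \<in> Hol_closed_disc"
      unfolding Hol_closed_disc_def by blast
  qed
  moreover have "openin (Hol_topology V) {h \<in> Hol V. zero_ext unit_disc h \<in> Hol_closed_disc}"
    if "open V" "cball 0 1 \<subseteq> V" for V
  proof -
    have "{h \<in> Hol V. zero_ext unit_disc h \<in> Hol_closed_disc} = Hol V"
      using in_closed that by blast
    then show ?thesis using Hol_small_open[of "{}" V 1] by simp
  qed
  ultimately have "Hol_closed_disc \<in> ?B" by blast
  then show "zero_ext unit_disc ` topspace (Hol_topology U) \<subseteq> \<Union>?B"
    using in_closed[OF _ U] by (auto simp: topspace_Hol)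
qed

locale analytic_Banach_space =
  fixes X :: "(complex \<Rightarrow> complex) set" and N :: "(complex \<Rightarrow> complex) \<Rightarrow> real"
  assumes Banach: "banach_space_of_analytic_functions X N"
begin

lemma X_Hol: "f \<in> X \<Longrightarrow> f \<in> Hol unit_disc"
  and zero_mem: "(\<lambda>z. 0) \<in> X"
  and add_mem: "f \<in> X \<Longrightarrow> h \<in> X \<Longrightarrow> (\<lambda>z. f z + h z) \<in> X"
  and scale_mem: "f \<in> X \<Longrightarrow> (\<lambda>z. c * f z) \<in> X"
  and N_nonneg: "f \<in> X \<Longrightarrow> 0 \<le> N f"
  and N_eq_0: "f \<in> X \<Longrightarrow> N f = 0 \<longleftrightarrow> f = (\<lambda>z. 0)"
  and N_scale: "f \<in> X \<Longrightarrow> N (\<lambda>z. c * f z) = cmod c * N f"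
  and N_triangle: "f \<in> X \<Longrightarrow> h \<in> X \<Longrightarrow> N (\<lambda>z. f z + h z) \<le> N f + N h"
  using Banach unfolding banach_space_of_analytic_functions_def normed_function_space_def by blast+

lemma holomorphic: "f \<in> X \<Longrightarrow> f holomorphic_on unit_disc"
  and outside: "f \<in> X \<Longrightarrow> z \<notin> unit_disc \<Longrightarrow> f z = 0"
  using X_Hol by (auto simp: Hol_def)

lemma N_scale_real: "f \<in> X \<Longrightarrow> 0 \<le> r \<Longrightarrow> N (\<lambda>z. complex_of_real r * f z) = r * N f"
  by (simp add: N_scale)

lemma N_zero: "N (\<lambda>z. 0) = 0"
  using N_eq_0[OF zero_mem] by simp

lemma diff_mem: "f \<in> X \<Longrightarrow> h \<in> X \<Longrightarrow> (\<lambda>z. f z - h z) \<in> X"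
  using add_mem[OF _ scale_mem[of h "-1"]] by force

lemma N_minus_commute: "f \<in> X \<Longrightarrow> h \<in> X \<Longrightarrow> N (\<lambda>z. f z - h z) = N (\<lambda>z. h z - f z)"
  using N_scale[OF diff_mem[of f h], of "-1"] by simp

lemma N_diff_triangle:
  "f \<in> X \<Longrightarrow> h \<in> X \<Longrightarrow> k \<in> X \<Longrightarrow> N (\<lambda>z. f z - k z) \<le> N (\<lambda>z. f z - h z) + N (\<lambda>z. h z - k z)"
  using N_triangle[OF diff_mem[of f h] diff_mem[of h k]] by simp

lemma N_diff_le: "f \<in> X \<Longrightarrow> h \<in> X \<Longrightarrow> N (\<lambda>z. f z - h z) \<le> N f + N h"
  using N_diff_triangle[OF _ zero_mem, of f h] N_minus_commute[OF zero_mem, of h] by simp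

lemma sum_mem: "(\<And>k. k \<in> A \<Longrightarrow> c k \<in> X) \<Longrightarrow> (\<lambda>z. \<Sum>k\<in>A. c k z) \<in> X"
  by (induction A rule: infinite_finite_induct) (auto intro: zero_mem add_mem)

lemma N_sum_le: "(\<And>k. k \<in> A \<Longrightarrow> c k \<in> X) \<Longrightarrow> N (\<lambda>z. \<Sum>k\<in>A. c k z) \<le> (\<Sum>k\<in>A. N (c k))"
proof (induction A rule: infinite_finite_induct)
  case (insert a A)
  then have "N (\<lambda>z. c a z + (\<Sum>k\<in>A. c k z)) \<le> N (c a) + N (\<lambda>z. \<Sum>k\<in>A. c k z)"
    by (intro N_triangle sum_mem) auto
  with insert show ?case by force
qed (auto simp: N_zero)

sublocale Metric_space X "norm_dist X N"
proof
  fix f h k assume "f \<in> X" "h \<in> X"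
  then show "norm_dist X N f h = 0 \<longleftrightarrow> f = h"
    using N_eq_0[OF diff_mem[of f h]] by (auto simp: norm_dist_def fun_eq_iff)
  assume "k \<in> X"
  then show "norm_dist X N f k \<le> norm_dist X N f h + norm_dist X N h k"
    using \<open>f \<in> X\<close> \<open>h \<in> X\<close> by (simp add: norm_dist_def N_diff_triangle)
next
  show "0 \<le> norm_dist X N f h" "norm_dist X N f h = norm_dist X N h f" for f h
    using N_nonneg[OF diff_mem[of f h]] N_minus_commute[of f h] by (auto simp: norm_dist_def)
qed

lemma mtopology_eq: "mtopology = norm_topology X N"
  by (simp add: norm_topology_def)

lemma limitin_norm_iff:
  "limitin (norm_topology X N) f l F \<longleftrightarrow>
     l \<in> X \<and> eventually (\<lambda>x. f x \<in> X) F \<and> ((\<lambda>x. N (\<lambda>z. f x z - l z)) \<longlongrightarrow> 0) F" (is "_ = ?R")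
proof -
  have "limitin (norm_topology X N) f l F \<longleftrightarrow>
     l \<in> X \<and> eventually (\<lambda>x. f x \<in> X) F \<and> ((\<lambda>x. norm_dist X N (f x) l) \<longlongrightarrow> 0) F"
    unfolding mtopology_eq[symmetric] by (rule limitin_metric_dist_null)
  also have "\<dots> \<longleftrightarrow> ?R"
  proof (intro conj_cong refl)
    assume "l \<in> X" and ev: "eventually (\<lambda>x. f x \<in> X) F"
    from ev have "eventually (\<lambda>x. norm_dist X N (f x) l = N (\<lambda>z. f x z - l z)) F"
      by eventually_elim (simp add: norm_dist_def \<open>l \<in> X\<close>)
    then show "((\<lambda>x. norm_dist X N (f x) l) \<longlongrightarrow> 0) F \<longleftrightarrow> ((\<lambda>x. N (\<lambda>z. f x z - l z)) \<longlongrightarrow> 0) F"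
      by (rule tendsto_cong)
  qed
  finally show ?thesis .
qed

lemma Cauchy_imp_limit:
  assumes mem: "\<And>n. \<sigma> n \<in> X"
    and Cauchy: "\<And>e. 0 < e \<Longrightarrow> \<exists>M. \<forall>m\<ge>M. \<forall>n\<ge>M. N (\<lambda>z. \<sigma> m z - \<sigma> n z) < e"
  obtains l where "l \<in> X" "(\<lambda>n. N (\<lambda>z. \<sigma> n z - l z)) \<longlonglongrightarrow> 0"
proof -
  have "mcomplete"
    using Banach by (simp add: banach_space_of_analytic_functions_def)
  moreover have "MCauchy \<sigma>"
    unfolding MCauchy_def using mem Cauchy by (fastforce simp: norm_dist_def)
  ultimately obtain l where "limitin mtopology \<sigma> l sequentially"
    unfolding mcomplete_def by blast
  then show ?thesis
    using that unfolding mtopology_eq limitin_norm_iff by blast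
qed

lemma openin_N_ball: "openin (norm_topology X N) {f \<in> X. N f < r}"
proof -
  have "{f \<in> X. N f < r} = mball (\<lambda>z. 0) r"
    using zero_mem N_minus_commute[OF zero_mem] by (auto simp: in_mball norm_dist_def)
  then show ?thesis unfolding mtopology_eq[symmetric] by simp
qed

lemma N_ball_in_open:
  assumes "openin (norm_topology X N) P" "(\<lambda>z. 0) \<in> P"
  obtains r where "0 < r" "\<And>f. f \<in> X \<Longrightarrow> N f < r \<Longrightarrow> f \<in> P"
proof -
  obtain r where "0 < r" "mball (\<lambda>z. 0) r \<subseteq> P"
    using assms unfolding mtopology_eq[symmetric] openin_mtopology by blast
  moreover have "f \<in> mball (\<lambda>z. 0) r" if "f \<in> X" "N f < r" for f
    using that zero_mem N_minus_commute[OF zero_mem, of f] by (auto simp: in_mball norm_dist_def)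
  ultimately show ?thesis using that by blast
qed

end

locale embedded_analytic_Banach_space = analytic_Banach_space +
  assumes from_closed_disc: "continuous_map Hol_closed_disc_topology (norm_topology X N) (\<lambda>f. f)"
    and into_Hol: "continuous_map (norm_topology X N) (Hol_topology unit_disc) (\<lambda>f. f)"
begin

text \<open>
  A continuous linear map is bounded: the preimage of a neighbourhood of 0 contains a norm ball, and
  homogeneity does the rest.
\<close>

lemma N_bounds_sup_on_compact:
  assumes "compact K" "K \<subseteq> unit_disc"
  obtains C where "0 < C" "\<And>f z. f \<in> X \<Longrightarrow> z \<in> K \<Longrightarrow> cmod (f z) \<le> C * N f"
proof -
  let ?P = "{h \<in> Hol unit_disc. \<forall>z\<in>K. cmod (h z) < 1}"
  have top: "topspace (norm_topology X N) = X"
    unfolding mtopology_eq[symmetric] by simp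
  have "openin (norm_topology X N) {f \<in> topspace (norm_topology X N). f \<in> ?P}"
    by (rule openin_continuous_map_preimage[OF into_Hol Hol_small_open]) (use assms in auto)
  then have "openin (norm_topology X N) {f \<in> X. f \<in> ?P}"
    unfolding top .
  moreover have "(\<lambda>z. 0) \<in> {f \<in> X. f \<in> ?P}"
    using zero_mem zero_in_Hol by auto
  ultimately obtain r where r: "0 < r" "\<And>f. f \<in> X \<Longrightarrow> N f < r \<Longrightarrow> f \<in> {f \<in> X. f \<in> ?P}"
    by (rule N_ball_in_open) blast
  show ?thesis
  proof (rule that[of "2 / r"])
    fix f z assume f: "f \<in> X" and z: "z \<in> K"
    show "cmod (f z) \<le> 2 / r * N f"
    proof (cases "N f = 0")
      case True
      then show ?thesis using N_eq_0[OF f] by auto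
    next
      case False
      then have pos: "0 < N f" using N_nonneg[OF f] by simp
      define c where "c = complex_of_real (r / (2 * N f))"
      have "N (\<lambda>z. c * f z) = r / 2"
        using r(1) pos unfolding N_scale[OF f]
        by (simp add: c_def norm_divide norm_mult)
      then have "cmod (c * f z) < 1"
        using r(2)[OF scale_mem[OF f, of c]] r(1) z by auto
      moreover have "cmod c = r / (2 * N f)" using r(1) pos by (simp add: c_def norm_divide norm_mult)
      ultimately show ?thesis
        using r(1) pos by (simp add: norm_mult field_simps)
    qed
  qed (use r in auto)
qed

lemma N_bounds_point:
  obtains C where "0 < C" "\<And>f. f \<in> X \<Longrightarrow> cmod (f z) \<le> C * N f"
proof (cases "z \<in> unit_disc")
  case True
  then have "compact {z}" "{z} \<subseteq> unit_disc" by auto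
  then obtain C where "0 < C" "\<And>f w. f \<in> X \<Longrightarrow> w \<in> {z} \<Longrightarrow> cmod (f w) \<le> C * N f"
    by (rule N_bounds_sup_on_compact) blast
  then show ?thesis by (intro that) auto
next
  case False
  then show ?thesis by (intro that[of 1]) (auto simp: outside N_nonneg)
qed

lemma N_convergence_imp_pointwise:
  assumes "\<And>n. \<sigma> n \<in> X" "l \<in> X" "((\<lambda>n. N (\<lambda>z. \<sigma> n z - l z)) \<longlongrightarrow> 0) F"
  shows "((\<lambda>n. \<sigma> n z) \<longlongrightarrow> l z) F"
proof -
  obtain C where C: "0 < C" "\<And>f. f \<in> X \<Longrightarrow> cmod (f z) \<le> C * N f"
    by (rule N_bounds_point[of z]) blast
  have "((\<lambda>n. \<sigma> n z - l z) \<longlongrightarrow> 0) F"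
  proof (rule Lim_null_comparison)
    show "eventually (\<lambda>n. cmod (\<sigma> n z - l z) \<le> C * N (\<lambda>z. \<sigma> n z - l z)) F"
      using C(2)[OF diff_mem[OF assms(1,2)]] by simp
    show "((\<lambda>n. C * N (\<lambda>z. \<sigma> n z - l z)) \<longlongrightarrow> 0) F"
      by (rule tendsto_mult_right_zero[OF assms(3)])
  qed
  then show ?thesis by (simp add: Lim_null[symmetric])
qed

definition disc_power :: "nat \<Rightarrow> complex \<Rightarrow> complex" where
  "disc_power k = zero_ext unit_disc (\<lambda>z. z ^ k)"

lemma disc_power_apply: "z \<in> unit_disc \<Longrightarrow> disc_power k z = z ^ k"
  by (simp add: disc_power_def zero_ext_def)

text \<open>
  On the disc of radius \<open>R\<close> the powers are bounded by \<open>R^k\<close>, and restriction to the unit disc is a continuous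
  linear map from the functions holomorphic on this larger disc to the space.
\<close>

lemma disc_power_growth:
  assumes "1 < R"
  obtains C where "\<And>k. disc_power k \<in> X" "\<And>k. N (disc_power k) \<le> C * R ^ k"
proof -
  define U where "U = ball (0::complex) R"
  have U: "open U" "cball 0 1 \<subseteq> U" using assms by (auto simp: U_def)
  have cont: "continuous_map (Hol_topology U) (norm_topology X N) (zero_ext unit_disc)"
    using continuous_map_compose[OF zero_ext_restriction_continuous[OF U] from_closed_disc]
    by (simp add: o_def)
  define q where "q k = zero_ext U (\<lambda>z. z ^ k)" for k
  have q: "q k \<in> Hol U" for k
  proof -
    have "(\<lambda>z. z ^ k) holomorphic_on U" by (intro holomorphic_intros)
    then show ?thesis
      unfolding q_def Hol_def zero_ext_def
      by (auto elim!: holomorphic_transform)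
  qed
  have zq: "zero_ext unit_disc (\<lambda>z. c * q k z) = (\<lambda>z. c * disc_power k z)" for c k
    using assms by (auto simp: U_def disc_power_def q_def zero_ext_def fun_eq_iff)
  have mem: "disc_power k \<in> X" for k
  proof -
    have "zero_ext unit_disc (q k) \<in> topspace (norm_topology X N)"
      using continuous_map_image_subset_topspace[OF cont] q[of k] unfolding topspace_Hol by blast
    then show ?thesis
      using zq[of 1 k] unfolding mtopology_eq[symmetric] by simp
  qed
  have "openin (Hol_topology U) {h \<in> topspace (Hol_topology U). zero_ext unit_disc h \<in> {f \<in> X. N f < 1}}"
    by (rule openin_continuous_map_preimage[OF cont openin_N_ball])
  moreover have "(\<lambda>z. 0) \<in> {h \<in> topspace (Hol_topology U). zero_ext unit_disc h \<in> {f \<in> X. N f < 1}}"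
    using zero_mem N_zero by (simp add: topspace_Hol zero_in_Hol zero_ext_def)
  ultimately obtain K e where K: "compact K" "K \<subseteq> U" "0 < e"
    and Ke: "\<And>h. h \<in> Hol U \<Longrightarrow> (\<And>z. z \<in> K \<Longrightarrow> cmod (h z) < e) \<Longrightarrow>
      h \<in> {h \<in> topspace (Hol_topology U). zero_ext unit_disc h \<in> {f \<in> X. N f < 1}}"
    by (rule zero_neighbourhood_Hol) blast
  have "N (disc_power k) \<le> 2 / e * R ^ k" for k
  proof -
    define c where "c = complex_of_real (e / (2 * R ^ k))"
    have "(\<lambda>z. c * q k z) \<in> {h \<in> topspace (Hol_topology U). zero_ext unit_disc h \<in> {f \<in> X. N f < 1}}"
    proof (rule Ke)
      show "(\<lambda>z. c * q k z) \<in> Hol U"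
        using q by (auto simp: Hol_def intro!: holomorphic_intros)
      fix z assume "z \<in> K"
      then have "z \<in> U" "cmod z \<le> R" using K(2) by (auto simp: U_def)
      then have "cmod (q k z) \<le> R ^ k"
        by (simp add: q_def zero_ext_def norm_power power_mono)
      then have "cmod (c * q k z) \<le> e / (2 * R ^ k) * R ^ k"
        unfolding norm_mult c_def norm_of_real using K(3) assms by (intro mult_mono) auto
      also have "\<dots> < e" using K(3) assms by simp
      finally show "cmod (c * q k z) < e" .
    qed
    then have "cmod c * N (disc_power k) < 1"
      using zq[of c k] by (simp add: N_scale[OF mem])
    moreover have "cmod c = e / (2 * R ^ k)"
      using K(3) assms by (simp add: c_def norm_divide norm_mult norm_power)
    ultimately show ?thesis
      using K(3) assms by (simp add: field_simps)
  qed
  then show ?thesis using that mem by blast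
qed

end

section \<open>Integrating curves in the space\<close>

lemma sum_div_lessThan:
  fixes f :: "nat \<Rightarrow> complex"
  assumes "0 < m"
  shows "(\<Sum>i<n * m. f (i div m)) = of_nat m * (\<Sum>k<n. f k)"
proof -
  have "(\<Sum>i<n * m. f (i div m)) = (\<Sum>k<n. \<Sum>i\<in>{k * m..<k * m + m}. f (i div m))"
    by (rule sum.nat_group[symmetric])
  also have "\<dots> = (\<Sum>k<n. \<Sum>i\<in>{k * m..<k * m + m}. f k)"
  proof (intro sum.cong refl)
    fix k i assume "i \<in> {k * m..<k * m + m}"
    then have "i div m = k" using assms
      by (intro div_nat_eqI) (auto simp: algebra_simps)
    then show "f (i div m) = f k" by simp
  qed
  finally show ?thesis by (simp add: sum_distrib_left)
qed

definition Riemann_sum :: "(real \<Rightarrow> complex \<Rightarrow> complex) \<Rightarrow> real \<Rightarrow> nat \<Rightarrow> complex \<Rightarrow> complex" where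
  "Riemann_sum c T n = (\<lambda>z. of_real (T / real n) * (\<Sum>k<n. c (real k * T / real n) z))"

lemma node_in_interval:
  fixes T :: real and k n :: nat
  assumes "0 \<le> T" "k < n"
  shows "real k * T / real n \<in> {0..T}"
proof -
  have "real k * T \<le> real n * T" using assms by (intro mult_right_mono) auto
  then show ?thesis using assms by (simp add: divide_le_eq mult.commute)
qed

text \<open>
  The node of the coarse partition to the left of the fine node number \<open>i\<close> has number \<open>i div m\<close>. Both sums
  thus become sums over the same index set.
\<close>

lemma Riemann_sum_refinement:
  assumes "0 < n" "0 < m"
  shows "Riemann_sum c T n z - Riemann_sum c T (n * m) z =
    of_real (T / real (n * m)) * (\<Sum>i<n * m. c (real (i div m) * T / real n) z - c (real i * T / real (n * m)) z)"
proof -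
  have "(\<Sum>i<n * m. c (real (i div m) * T / real n) z) = of_nat m * (\<Sum>k<n. c (real k * T / real n) z)"
    by (rule sum_div_lessThan[OF assms(2), of "\<lambda>k. c (real k * T / real n) z"])
  then show ?thesis
    using assms by (simp add: Riemann_sum_def sum_subtractf algebra_simps)
qed

lemma refinement_node_dist:
  fixes T :: real and i m n :: nat
  assumes "0 \<le> T" "0 < n" "0 < m"
  shows "\<bar>real (i div m) * T / real n - real i * T / real (n * m)\<bar> \<le> T / real n"
proof -
  have "real i = real m * real (i div m) + real (i mod m)"
    by (metis of_nat_add of_nat_mult mult_div_mod_eq)
  then have "real (i div m) * T / real n - real i * T / real (n * m) = - (real (i mod m) * T / real (n * m))"
    using assms by (simp add: field_simps)
  moreover have "real (i mod m) * T / real (n * m) \<le> real m * T / real (n * m)"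
    using assms by (intro divide_right_mono mult_right_mono) (auto intro: less_imp_le)
  moreover have "real m * T / real (n * m) = T / real n" "0 \<le> real (i mod m) * T / real (n * m)"
    using assms by auto
  ultimately show ?thesis by linarith
qed

lemma Riemann_sum_integral_error:
  fixes u :: "real \<Rightarrow> complex" and n :: nat
  assumes T: "0 \<le> T" "0 < n" and cont: "continuous_on {0..T} u"
    and osc: "\<And>s t. s \<in> {0..T} \<Longrightarrow> t \<in> {0..T} \<Longrightarrow> \<bar>s - t\<bar> \<le> T / real n \<Longrightarrow> cmod (u s - u t) \<le> e"
  shows "cmod (of_real (T / real n) * (\<Sum>k<n. u (real k * T / real n)) - integral {0..T} u) \<le> T * e"
proof -
  define F where "F x = integral {0..x} u" for x
  define p where "p k = real k * T / real n" for k :: nat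
  have p: "p k \<in> {0..T}" if "k \<le> n" for k
  proof -
    have "real k * T \<le> real n * T" using that T by (intro mult_right_mono) auto
    then show ?thesis using T by (auto simp: p_def divide_le_eq mult.commute)
  qed
  have step: "p (Suc k) - p k = T / real n" for k
    by (simp add: p_def algebra_simps add_divide_distrib)
  have piece: "cmod (F (p (Suc k)) - F (p k) - of_real (T / real n) * u (p k)) \<le> T / real n * e" if k: "k < n" for k
  proof -
    have "0 \<le> T / real n" using T by simp
    then have le: "p k \<le> p (Suc k)" using step[of k] by linarith
    have pk: "p k \<in> {0..T}" "p (Suc k) \<in> {0..T}" using p k by auto
    have sub: "{p k..p (Suc k)} \<subseteq> {0..T}" using pk by auto
    have int: "u integrable_on {0..p (Suc k)}"
      by (rule integrable_continuous_interval, rule continuous_on_subset[OF cont]) (use pk in auto)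
    have cont': "continuous_on {p k..p (Suc k)} u"
      using cont sub by (rule continuous_on_subset)
    have "F (p (Suc k)) - F (p k) = integral {p k..p (Suc k)} u"
      unfolding F_def using Henstock_Kurzweil_Integration.integral_combine[OF _ le int] pk by (auto simp: algebra_simps)
    moreover have "integral {p k..p (Suc k)} (\<lambda>s. u (p k)) = of_real (T / real n) * u (p k)"
      using le step[of k] by (simp add: scaleR_conv_of_real)
    ultimately have "F (p (Suc k)) - F (p k) - of_real (T / real n) * u (p k)
        = integral {p k..p (Suc k)} (\<lambda>s. u s - u (p k))"
      using integral_diff[OF integrable_continuous_interval[OF cont'] integrable_const_ivl[of "u (p k)" "p k" "p (Suc k)"]]
      by simp
    also have "cmod \<dots> \<le> e * (p (Suc k) - p k)"
    proof (rule integral_bound[OF le])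
      show "cmod (u s - u (p k)) \<le> e" if "s \<in> {p k..p (Suc k)}" for s
        using osc[of s "p k"] that sub pk step[of k] by auto
    qed (intro continuous_intros cont')
    finally show ?thesis using step[of k] by (simp add: mult.commute)
  qed
  have "F (p n) - F (p 0) = (\<Sum>k<n. F (p (Suc k)) - F (p k))"
    by (rule sum_lessThan_telescope[symmetric])
  moreover have "p n = T" "F (p 0) = 0" using T by (auto simp: p_def F_def)
  ultimately have "integral {0..T} u - of_real (T / real n) * (\<Sum>k<n. u (p k)) =
      (\<Sum>k<n. F (p (Suc k)) - F (p k) - of_real (T / real n) * u (p k))"
    by (simp add: F_def sum_subtractf sum_distrib_left)
  also have "cmod \<dots> \<le> (\<Sum>k<n. T / real n * e)"
    by (intro sum_norm_le piece) auto
  also have "\<dots> = T * e" using T by simp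
  finally show ?thesis by (simp add: norm_minus_commute p_def)
qed

context embedded_analytic_Banach_space
begin

text \<open>
  Only the values on \<open>[0,T]\<close> matter, and membership in the space is part of the notion, because the norm carries no
  information off the space.
\<close>

definition N_uniformly_continuous :: "real \<Rightarrow> (real \<Rightarrow> complex \<Rightarrow> complex) \<Rightarrow> bool" where
  "N_uniformly_continuous T c \<longleftrightarrow> (\<forall>s\<in>{0..T}. c s \<in> X) \<and>
     (\<forall>e>0. \<exists>d>0. \<forall>s\<in>{0..T}. \<forall>t\<in>{0..T}. \<bar>s - t\<bar> < d \<longrightarrow> N (\<lambda>z. c s z - c t z) < e)"

lemma N_uniformly_continuousE:
  assumes "N_uniformly_continuous T c" "0 < e"
  obtains d where "0 < d"
    "\<And>s t. s \<in> {0..T} \<Longrightarrow> t \<in> {0..T} \<Longrightarrow> \<bar>s - t\<bar> < d \<Longrightarrow> N (\<lambda>z. c s z - c t z) < e"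
proof -
  from assms have "\<exists>d>0. \<forall>s\<in>{0..T}. \<forall>t\<in>{0..T}. \<bar>s - t\<bar> < d \<longrightarrow> N (\<lambda>z. c s z - c t z) < e"
    unfolding N_uniformly_continuous_def by simp
  then obtain d where "0 < d" "\<forall>s\<in>{0..T}. \<forall>t\<in>{0..T}. \<bar>s - t\<bar> < d \<longrightarrow> N (\<lambda>z. c s z - c t z) < e"
    by (elim exE conjE)
  then show ?thesis by (intro that) auto
qed

lemma N_uniformly_continuous_imp_pointwise:
  assumes "N_uniformly_continuous T c"
  shows "continuous_on {0..T} (\<lambda>s. c s z)"
proof -
  obtain C where C: "0 < C" "\<And>f. f \<in> X \<Longrightarrow> cmod (f z) \<le> C * N f"
    by (rule N_bounds_point[of z]) blast
  have "uniformly_continuous_on {0..T} (\<lambda>s. c s z)"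
    unfolding uniformly_continuous_on_def
  proof (intro allI impI)
    fix e :: real assume "0 < e"
    then have "0 < e / C" using C by simp
    then obtain d where d: "0 < d" "\<And>s t. s \<in> {0..T} \<Longrightarrow> t \<in> {0..T} \<Longrightarrow> \<bar>s - t\<bar> < d \<Longrightarrow> N (\<lambda>z. c s z - c t z) < e / C"
      by (rule N_uniformly_continuousE[OF assms]) blast
    show "\<exists>d>0. \<forall>s\<in>{0..T}. \<forall>t\<in>{0..T}. dist t s < d \<longrightarrow> dist (c t z) (c s z) < e"
    proof (intro exI[of _ d] conjI ballI impI d)
      fix s t assume st: "s \<in> {0..T}" "t \<in> {0..T}" "dist t s < d"
      then have "cmod (c t z - c s z) \<le> C * N (\<lambda>z. c t z - c s z)"
        using C(2)[OF diff_mem[of "c t" "c s"]] assms by (simp add: N_uniformly_continuous_def)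
      also have "\<dots> < C * (e / C)"
        using d(2)[of t s] st C(1) by (intro mult_strict_left_mono) (auto simp: dist_real_def)
      finally show "dist (c t z) (c s z) < e" using C(1) by (simp add: dist_norm)
    qed
  qed
  then show ?thesis by (rule uniformly_continuous_imp_continuous)
qed

lemma Riemann_sum_mem:
  assumes "\<And>s. s \<in> {0..T} \<Longrightarrow> c s \<in> X" "0 \<le> T"
  shows "Riemann_sum c T n \<in> X"
  unfolding Riemann_sum_def
  by (intro scale_mem sum_mem assms node_in_interval) auto

lemma N_Riemann_sum_le:
  assumes mem: "\<And>s. s \<in> {0..T} \<Longrightarrow> c s \<in> X" and T: "0 \<le> T" "0 < n"
    and B: "\<And>s. s \<in> {0..T} \<Longrightarrow> N (c s) \<le> B"
  shows "N (Riemann_sum c T n) \<le> T * B"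
proof -
  have m: "c (real k * T / real n) \<in> X" if "k < n" for k :: nat
    using mem node_in_interval[OF T(1) that] by blast
  have "N (Riemann_sum c T n) = T / real n * N (\<lambda>z. \<Sum>k<n. c (real k * T / real n) z)"
    unfolding Riemann_sum_def using m T by (intro N_scale_real sum_mem) auto
  also have "\<dots> \<le> T / real n * (\<Sum>k<n. B)"
    using T m by (intro mult_left_mono order_trans[OF N_sum_le] sum_mono B node_in_interval) auto
  finally show ?thesis using T by simp
qed

lemma N_Riemann_sum_refinement:
  assumes c: "\<And>s. s \<in> {0..T} \<Longrightarrow> c s \<in> X" and T: "0 \<le> T" "0 < n" "0 < m"
    and osc: "\<And>s t. s \<in> {0..T} \<Longrightarrow> t \<in> {0..T} \<Longrightarrow> \<bar>s - t\<bar> \<le> T / real n \<Longrightarrow> N (\<lambda>z. c s z - c t z) \<le> e"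
  shows "N (\<lambda>z. Riemann_sum c T n z - Riemann_sum c T (n * m) z) \<le> T * e"
proof -
  define D where "D i = (\<lambda>z. c (real (i div m) * T / real n) z - c (real i * T / real (n * m)) z)" for i :: nat
  have nodes: "real (i div m) * T / real n \<in> {0..T}" "real i * T / real (n * m) \<in> {0..T}" if "i < n * m" for i
  proof -
    have "i div m < n" using that by (simp add: less_mult_imp_div_less)
    then show "real (i div m) * T / real n \<in> {0..T}" by (rule node_in_interval[OF T(1)])
    show "real i * T / real (n * m) \<in> {0..T}" using node_in_interval[OF T(1) that] by simp
  qed
  have D: "D i \<in> X" "N (D i) \<le> e" if "i < n * m" for i
    unfolding D_def using nodes[OF that] refinement_node_dist[OF T]
    by (auto intro!: diff_mem c osc)
  have "N (\<lambda>z. Riemann_sum c T n z - Riemann_sum c T (n * m) z) = T / real (n * m) * N (\<lambda>z. \<Sum>i<n*m. D i z)"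
    unfolding Riemann_sum_refinement[OF T(2,3)]
    using N_scale_real[OF sum_mem[of "{..<n*m}" D], of "T / real (n * m)"] D T
    unfolding D_def by simp
  also have "\<dots> \<le> T / real (n * m) * (\<Sum>i<n*m. e)"
    using T D by (intro mult_left_mono order_trans[OF N_sum_le] sum_mono) auto
  finally show ?thesis using T by simp
qed

text \<open>
  The Riemann sums with \<open>m\<close> and with \<open>n\<close> pieces are both close to the one with \<open>m * n\<close> pieces, so they form a
  Cauchy sequence. Its limit in norm is also the pointwise limit, which is the integral.
\<close>

lemma integral_mem_and_Riemann_limit:
  assumes T: "0 \<le> T" and c: "N_uniformly_continuous T c"
  defines "I \<equiv> \<lambda>z. integral {0..T} (\<lambda>s. c s z)"
  shows "I \<in> X" "(\<lambda>n. N (\<lambda>z. Riemann_sum c T (Suc n) z - I z)) \<longlonglongrightarrow> 0"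
proof -
  have mem: "c s \<in> X" if "s \<in> {0..T}" for s
    using c that by (simp add: N_uniformly_continuous_def)
  have osc: "\<exists>M>0. \<forall>n\<ge>M. \<forall>s\<in>{0..T}. \<forall>t\<in>{0..T}. \<bar>s - t\<bar> \<le> T / real n \<longrightarrow> N (\<lambda>z. c s z - c t z) \<le> e" if "0 < e" for e
  proof -
    obtain d where d: "0 < d" "\<And>s t. s \<in> {0..T} \<Longrightarrow> t \<in> {0..T} \<Longrightarrow> \<bar>s - t\<bar> < d \<Longrightarrow> N (\<lambda>z. c s z - c t z) < e"
      by (rule N_uniformly_continuousE[OF c \<open>0 < e\<close>]) blast
    obtain M where M: "T / d < real M" using reals_Archimedean2 by blast
    have "T / real n < d" if "Suc M \<le> n" for n
    proof -
      have "T / d < real n" using M that by linarith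
      moreover have "0 < real n" using that by simp
      ultimately show ?thesis using d(1) by (simp add: field_simps)
    qed
    then show ?thesis using d(2) by (intro exI[of _ "Suc M"]) (force intro: less_imp_le)
  qed
  let ?R = "\<lambda>n. Riemann_sum c T (Suc n)"
  have Rm: "?R n \<in> X" for n by (intro Riemann_sum_mem mem T)
  have Cauchy: "\<exists>M. \<forall>m\<ge>M. \<forall>n\<ge>M. N (\<lambda>z. ?R m z - ?R n z) < e" if e: "0 < e" for e
  proof -
    (* The summand 1 covers the degenerate interval with T = 0. *)
    define e' where "e' = e / (2 * T + 1)"
    have e': "0 < e'" using e T by (simp add: e'_def)
    from osc[OF this] obtain M where M: "M > 0"
      "\<And>n s t. n \<ge> M \<Longrightarrow> s \<in> {0..T} \<Longrightarrow> t \<in> {0..T} \<Longrightarrow> \<bar>s - t\<bar> \<le> T / real n \<Longrightarrow> N (\<lambda>z. c s z - c t z) \<le> e'"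
      by blast
    have "N (\<lambda>z. ?R m z - ?R n z) < e" if mn: "m \<ge> M" "n \<ge> M" for m n
    proof -
      have Rmn: "Riemann_sum c T (Suc m * Suc n) \<in> X" by (intro Riemann_sum_mem mem T)
      have "N (\<lambda>z. ?R m z - ?R n z) \<le> N (\<lambda>z. ?R m z - Riemann_sum c T (Suc m * Suc n) z)
          + N (\<lambda>z. Riemann_sum c T (Suc m * Suc n) z - ?R n z)"
        by (intro N_diff_triangle Rm Rmn)
      also have "N (\<lambda>z. Riemann_sum c T (Suc m * Suc n) z - ?R n z) = N (\<lambda>z. ?R n z - Riemann_sum c T (Suc n * Suc m) z)"
        unfolding mult.commute[of "Suc m"] by (intro N_minus_commute Rm Rmn[unfolded mult.commute[of "Suc m"]])
      also have "N (\<lambda>z. ?R m z - Riemann_sum c T (Suc m * Suc n) z) \<le> T * e'"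
        using mn by (intro N_Riemann_sum_refinement mem T M(2)[of "Suc m"]) auto
      also have "N (\<lambda>z. ?R n z - Riemann_sum c T (Suc n * Suc m) z) \<le> T * e'"
        using mn by (intro N_Riemann_sum_refinement mem T M(2)[of "Suc n"]) auto
      also have "T * e' + T * e' < (2 * T + 1) * e'" using e' by (simp add: algebra_simps)
      also have "\<dots> = e" using T by (simp add: e'_def)
      finally show ?thesis by simp
    qed
    then show ?thesis by blast
  qed
  obtain l where l: "l \<in> X" "(\<lambda>n. N (\<lambda>z. ?R n z - l z)) \<longlonglongrightarrow> 0"
    using Cauchy_imp_limit[of ?R, OF Rm Cauchy] by blast
  have "l z = I z" for z
  proof -
    obtain C where C: "0 < C" "\<And>f. f \<in> X \<Longrightarrow> cmod (f z) \<le> C * N f"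
      by (rule N_bounds_point[of z]) blast
    have cont: "continuous_on {0..T} (\<lambda>s. c s z)"
      by (rule N_uniformly_continuous_imp_pointwise[OF c])
    have "(\<lambda>n. ?R n z) \<longlonglongrightarrow> I z"
    proof (rule LIMSEQ_I)
      fix e :: real assume e: "0 < e"
      define e' where "e' = e / (C * (T + 1))"
      have e': "0 < e'" using e T C by (simp add: e'_def)
      from osc[OF this] obtain M where M: "M > 0"
      "\<And>n s t. n \<ge> M \<Longrightarrow> s \<in> {0..T} \<Longrightarrow> t \<in> {0..T} \<Longrightarrow> \<bar>s - t\<bar> \<le> T / real n \<Longrightarrow> N (\<lambda>z. c s z - c t z) \<le> e'"
        by blast
      have "norm (?R n z - I z) < e" if n: "n \<ge> M" for n
      proof -
        have "cmod (c s z - c t z) \<le> C * e'" if "s \<in> {0..T}" "t \<in> {0..T}" "\<bar>s - t\<bar> \<le> T / real (Suc n)" for s t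
        proof -
          have "cmod (c s z - c t z) \<le> C * N (\<lambda>z. c s z - c t z)"
            using C(2)[OF diff_mem[OF mem mem]] that by blast
          also have "\<dots> \<le> C * e'"
            using M(2)[of "Suc n" s t] n that C(1) by (intro mult_left_mono) auto
          finally show ?thesis .
        qed
        then have "cmod (of_real (T / real (Suc n)) * (\<Sum>k<Suc n. c (real k * T / real (Suc n)) z)
            - integral {0..T} (\<lambda>s. c s z)) \<le> T * (C * e')"
          by (intro Riemann_sum_integral_error T cont) auto
        also have "\<dots> < C * (T + 1) * e'" using e' C(1) by (simp add: algebra_simps)
        also have "\<dots> = e" using T C(1) by (simp add: e'_def)
        finally show ?thesis unfolding Riemann_sum_def I_def .
      qed
      then show "\<exists>no. \<forall>n\<ge>no. norm (?R n z - I z) < e" by blast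
    qed
    moreover have "(\<lambda>n. ?R n z) \<longlonglongrightarrow> l z"
      using l Rm by (intro N_convergence_imp_pointwise)
    ultimately show ?thesis using LIMSEQ_unique by blast
  qed
  then have "l = I" by blast
  then show "I \<in> X" "(\<lambda>n. N (\<lambda>z. ?R n z - I z)) \<longlonglongrightarrow> 0" using l by auto
qed

lemma N_integral_le:
  assumes T: "0 \<le> T" and c: "N_uniformly_continuous T c"
    and B: "\<And>s. s \<in> {0..T} \<Longrightarrow> N (c s) \<le> B"
  shows "N (\<lambda>z. integral {0..T} (\<lambda>s. c s z)) \<le> T * B"
proof (rule LIMSEQ_le_const)
  let ?I = "\<lambda>z. integral {0..T} (\<lambda>s. c s z)"
  let ?R = "\<lambda>n. Riemann_sum c T (Suc n)"
  have mem: "c s \<in> X" if "s \<in> {0..T}" for s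
    using c that by (simp add: N_uniformly_continuous_def)
  note I = integral_mem_and_Riemann_limit[OF T c]
  show "(\<lambda>n. N (\<lambda>z. ?R n z - ?I z) + T * B) \<longlonglongrightarrow> T * B"
    using tendsto_add[OF I(2) tendsto_const] by simp
  have "N ?I \<le> N (\<lambda>z. ?R n z - ?I z) + T * B" for n
  proof -
    have R: "?R n \<in> X" by (intro Riemann_sum_mem mem T)
    have "N ?I \<le> N (\<lambda>z. ?I z - ?R n z) + N (?R n)"
      using N_triangle[OF diff_mem[OF I(1) R] R] by simp
    also have "N (\<lambda>z. ?I z - ?R n z) = N (\<lambda>z. ?R n z - ?I z)"
      by (rule N_minus_commute[OF I(1) R])
    also have "N (?R n) \<le> T * B"
      by (intro N_Riemann_sum_le mem T B) auto
    finally show ?thesis by simp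
  qed
  then show "\<exists>N'. \<forall>n\<ge>N'. N ?I \<le> N (\<lambda>z. ?R n z - ?I z) + T * B" by blast
qed

end

section \<open>Strongly continuous semigroups and their integrated orbits\<close>

locale analytic_semigroup = embedded_analytic_Banach_space +
  fixes S :: "real \<Rightarrow> (complex \<Rightarrow> complex) \<Rightarrow> complex \<Rightarrow> complex"
  assumes C0: "C0_semigroup X N S"
begin

lemma bounded_op: "0 \<le> t \<Longrightarrow> bounded_operator X N (S t)"
  and S_0: "f \<in> X \<Longrightarrow> S 0 f = f"
  and S_S: "0 \<le> t \<Longrightarrow> 0 \<le> s \<Longrightarrow> f \<in> X \<Longrightarrow> S t (S s f) = S (t + s) f"
  using C0 by (auto simp: C0_semigroup_def)

lemma S_mem: "0 \<le> t \<Longrightarrow> f \<in> X \<Longrightarrow> S t f \<in> X"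
  and S_add: "0 \<le> t \<Longrightarrow> f \<in> X \<Longrightarrow> h \<in> X \<Longrightarrow> S t (\<lambda>z. f z + h z) = (\<lambda>z. S t f z + S t h z)"
  and S_scale: "0 \<le> t \<Longrightarrow> f \<in> X \<Longrightarrow> S t (\<lambda>z. c * f z) = (\<lambda>z. c * S t f z)"
  using bounded_op by (auto simp: bounded_operator_def)

lemma S_bounded:
  assumes "0 \<le> t"
  obtains C where "0 < C" "\<And>f. f \<in> X \<Longrightarrow> N (S t f) \<le> C * N f"
proof -
  obtain C where C: "\<And>f. f \<in> X \<Longrightarrow> N (S t f) \<le> C * N f"
    using bounded_op[OF assms] unfolding bounded_operator_def by blast
  show ?thesis
  proof (rule that[of "\<bar>C\<bar> + 1"])
    fix f assume f: "f \<in> X"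
    have "C * N f \<le> (\<bar>C\<bar> + 1) * N f" using N_nonneg[OF f] by (intro mult_right_mono) auto
    then show "N (S t f) \<le> (\<bar>C\<bar> + 1) * N f" using C[OF f] by linarith
  qed auto
qed

lemma S_diff: "0 \<le> t \<Longrightarrow> f \<in> X \<Longrightarrow> h \<in> X \<Longrightarrow> S t (\<lambda>z. f z - h z) = (\<lambda>z. S t f z - S t h z)"
  using S_add[of t f "\<lambda>z. -1 * h z"] S_scale[of t h "-1"] scale_mem[of h "-1"] by simp

lemma S_zero: "0 \<le> t \<Longrightarrow> S t (\<lambda>z. 0) = (\<lambda>z. 0)"
  using S_scale[OF _ zero_mem, of t 0] by simp

lemma S_sum:
  assumes "0 \<le> t" "\<And>k. k \<in> A \<Longrightarrow> c k \<in> X"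
  shows "S t (\<lambda>z. \<Sum>k\<in>A. c k z) = (\<lambda>z. \<Sum>k\<in>A. S t (c k) z)"
  using assms(2)
proof (induction A rule: infinite_finite_induct)
  case (insert a A)
  then show ?case using S_add[OF assms(1), of "c a" "\<lambda>z. \<Sum>k\<in>A. c k z"] sum_mem[of A c] by simp
qed (auto simp: S_zero assms)

lemma right_continuous_at_0: "f \<in> X \<Longrightarrow> ((\<lambda>t. N (\<lambda>z. S t f z - f z)) \<longlongrightarrow> 0) (at_right 0)"
  using C0 unfolding C0_semigroup_def limitin_norm_iff by blast

text \<open>
  The sets to which Baire's theorem is applied. The time interval shrinks as the bound grows, since
  strong continuity at 0 bounds an orbit only for short times, depending on the orbit.
\<close>

definition orbit_bound_set :: "nat \<Rightarrow> (complex \<Rightarrow> complex) set" where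
  "orbit_bound_set n = {f \<in> X. \<forall>t\<in>{0..1 / real (Suc n)}. N (S t f) \<le> real (Suc n)}"

lemma closedin_orbit_bound_set: "closedin mtopology (orbit_bound_set n)"
  unfolding closedin_metric
proof (intro conjI allI impI)
  show "orbit_bound_set n \<subseteq> X" by (auto simp: orbit_bound_set_def)
  fix f assume "f \<in> X - orbit_bound_set n"
  then obtain t where f: "f \<in> X" and t: "t \<in> {0..1 / real (Suc n)}" "N (S t f) > real (Suc n)"
    by (auto simp: orbit_bound_set_def not_le)
  then have "0 \<le> t" by auto
  obtain C where C: "0 < C" "\<And>f. f \<in> X \<Longrightarrow> N (S t f) \<le> C * N f"
    using S_bounded[OF \<open>0 \<le> t\<close>] by blast
  define r where "r = (N (S t f) - real (Suc n)) / C"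
  have "h \<notin> orbit_bound_set n" if h: "h \<in> mball f r" for h
  proof
    assume hb: "h \<in> orbit_bound_set n"
    have hX: "h \<in> X" using h by simp
    have "N (\<lambda>z. f z - h z) < r" using h f hX by (auto simp: in_mball norm_dist_def)
    then have "C * N (\<lambda>z. f z - h z) < N (S t f) - real (Suc n)"
      using C(1) by (simp add: r_def field_simps)
    moreover have "N (\<lambda>z. S t f z - S t h z) \<le> C * N (\<lambda>z. f z - h z)"
      using C(2)[OF diff_mem[OF f hX]] S_diff[OF \<open>0 \<le> t\<close> f hX] by simp
    moreover have "N (S t f) \<le> N (\<lambda>z. S t f z - S t h z) + N (S t h)"
      using N_triangle[OF diff_mem[of "S t f" "S t h"] S_mem[OF \<open>0 \<le> t\<close> hX]] S_mem[OF \<open>0 \<le> t\<close>] f hX by simp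
    moreover have "N (S t h) \<le> real (Suc n)"
      using hb t by (auto simp: orbit_bound_set_def)
    ultimately show False by linarith
  qed
  then have "disjnt (orbit_bound_set n) (mball f r)" by (auto simp: disjnt_iff)
  moreover have "0 < r" using t C by (simp add: r_def)
  ultimately show "\<exists>r>0. disjnt (orbit_bound_set n) (mball f r)" by blast
qed

lemma orbit_bound_sets_cover: "(\<Union>n. orbit_bound_set n) = X"
proof
  show "X \<subseteq> (\<Union>n. orbit_bound_set n)"
  proof
    fix f assume f: "f \<in> X"
    have "eventually (\<lambda>t. N (\<lambda>z. S t f z - f z) < 1) (at_right 0)"
      using order_tendstoD(2)[OF right_continuous_at_0[OF f]] by simp
    then obtain b where b: "0 < b" "\<And>t. 0 < t \<Longrightarrow> t < b \<Longrightarrow> N (\<lambda>z. S t f z - f z) < 1"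
      unfolding eventually_at_right_field by auto
    obtain n where n: "max (1 / b) (N f + 1) < real n" using reals_Archimedean2 by blast
    have "N (S t f) \<le> real (Suc n)" if t: "t \<in> {0..1 / real (Suc n)}" for t
    proof (cases "t = 0")
      case True
      then show ?thesis using n S_0[OF f] by simp
    next
      case False
      have "1 < real n * b" using n b(1) by (simp add: divide_less_eq)
      then have "1 / real (Suc n) < b" using b(1) by (simp add: divide_less_eq distrib_left distrib_right mult.commute)
      then have "N (\<lambda>z. S t f z - f z) < 1" using b(2)[of t] t False by simp
      moreover have "N (S t f) \<le> N (\<lambda>z. S t f z - f z) + N f"
        using N_triangle[OF diff_mem[of "S t f" f] f] S_mem[of t f] f t by simp
      ultimately show ?thesis using n by simp
    qed
    then show "f \<in> (\<Union>n. orbit_bound_set n)" using f unfolding orbit_bound_set_def by blast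
  qed
qed (auto simp: orbit_bound_set_def)

lemma orbit_bound_set_nonmeagre:
  obtains n f r where "f \<in> X" "0 < r" "mball f r \<subseteq> orbit_bound_set n"
proof -
  have "\<exists>n. mtopology interior_of orbit_bound_set n \<noteq> {}"
  proof (rule ccontr)
    assume "\<not> ?thesis"
    then have "mtopology interior_of \<Union>(range orbit_bound_set) = {}"
      using Banach closedin_orbit_bound_set
      by (intro metric_Baire_category_alt) (auto simp: banach_space_of_analytic_functions_def)
    moreover have "mtopology interior_of X = X"
      using interior_of_topspace[of mtopology] by simp
    ultimately show False using orbit_bound_sets_cover zero_mem by simp
  qed
  then obtain n f where "f \<in> mtopology interior_of orbit_bound_set n" by blast
  then obtain U where U: "openin mtopology U" "f \<in> U" "U \<subseteq> orbit_bound_set n"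
    by (auto simp: interior_of_def)
  then obtain r where "0 < r" "mball f r \<subseteq> U" unfolding openin_mtopology by blast
  moreover have "f \<in> X" using U by (auto simp: orbit_bound_set_def)
  ultimately show ?thesis using U that by (meson order_trans)
qed

text \<open>
  The principle of uniform boundedness for the family of operators with small time parameter: some \<open>orbit_bound_set\<close>
  contains a ball, and linearity moves the ball to the origin and rescales it.
\<close>

lemma locally_bounded:
  obtains \<delta> M where "0 < \<delta>" "1 \<le> M" "\<And>t f. t \<in> {0..\<delta>} \<Longrightarrow> f \<in> X \<Longrightarrow> N (S t f) \<le> M * N f"
proof -
  obtain n f\<^sub>0 r where f0: "f\<^sub>0 \<in> X" and r: "0 < r" "mball f\<^sub>0 r \<subseteq> orbit_bound_set n"
    by (rule orbit_bound_set_nonmeagre)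
  define B where "B = real (Suc n)"
  have small: "N (S t h) \<le> 2 * B" if t: "t \<in> {0..1 / B}" and h: "h \<in> X" "N h < r" for t h
  proof -
    have t0: "0 \<le> t" using t by simp
    have "(\<lambda>z. f\<^sub>0 z + h z) \<in> mball f\<^sub>0 r"
      using f0 h add_mem[OF f0 h(1)] N_minus_commute[OF f0 add_mem[OF f0 h(1)]]
      by (simp add: in_mball norm_dist_def)
    then have "N (S t (\<lambda>z. f\<^sub>0 z + h z)) \<le> B"
      using r(2) t by (auto simp: orbit_bound_set_def B_def)
    moreover have "f\<^sub>0 \<in> mball f\<^sub>0 r" using f0 r(1) by simp
    then have "f\<^sub>0 \<in> orbit_bound_set n" using r(2) by blast
    then have "N (S t f\<^sub>0) \<le> B"
      using t unfolding orbit_bound_set_def B_def by blast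
    moreover have "N (S t h) \<le> N (S t (\<lambda>z. f\<^sub>0 z + h z)) + N (S t f\<^sub>0)"
      using N_diff_le[OF S_mem[OF t0 add_mem[OF f0 h(1)]] S_mem[OF t0 f0]] S_add[OF t0 f0 h(1)] by simp
    ultimately show ?thesis by simp
  qed
  define M where "M = max 1 (4 * B / r)"
  have "N (S t f) \<le> M * N f" if t: "t \<in> {0..1 / B}" and f: "f \<in> X" for t f
  proof (cases "N f = 0")
    case True
    then have "f = (\<lambda>z. 0)" using N_eq_0[OF f] by simp
    then show ?thesis using S_zero[of t] N_zero t by simp
  next
    case False
    then have pos: "0 < N f" using N_nonneg[OF f] by simp
    define a where "a = r / (2 * N f)"
    have a: "0 < a" using r pos by (simp add: a_def)
    have "N (\<lambda>z. complex_of_real a * f z) < r"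
      using N_scale_real[OF f, of a] a r pos by (simp add: a_def)
    then have "N (S t (\<lambda>z. complex_of_real a * f z)) \<le> 2 * B"
      by (intro small t scale_mem f)
    moreover have "N (S t (\<lambda>z. complex_of_real a * f z)) = a * N (S t f)"
      using S_scale[of t f "complex_of_real a"] N_scale_real[OF S_mem[of t f], of a] t f a by simp
    ultimately have "a * N (S t f) \<le> 2 * B" by simp
    then have "N (S t f) \<le> 2 * B / a" using a by (simp add: field_simps)
    also have "\<dots> = 4 * B / r * N f" using r pos by (simp add: a_def)
    also have "\<dots> \<le> M * N f" using pos by (intro mult_right_mono) (auto simp: M_def)
    finally show ?thesis .
  qed
  then show ?thesis by (intro that[of "1 / B" M]) (auto simp: B_def M_def)
qed

lemma bounded_on_compact_time:
  obtains M where "1 \<le> M" "\<And>t f. t \<in> {0..T} \<Longrightarrow> f \<in> X \<Longrightarrow> N (S t f) \<le> M * N f"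
proof -
  obtain \<delta> M where M: "0 < \<delta>" "1 \<le> M" "\<And>t f. t \<in> {0..\<delta>} \<Longrightarrow> f \<in> X \<Longrightarrow> N (S t f) \<le> M * N f"
    by (rule locally_bounded) blast
  have step: "N (S t f) \<le> M ^ Suc n * N f" if "t \<in> {0..real (Suc n) * \<delta>}" "f \<in> X" for n t f
    using that
  proof (induction n arbitrary: t)
    case 0
    then show ?case using M(3)[of t f] by simp
  next
    case (Suc n)
    show ?case
    proof (cases "t \<le> \<delta>")
      case True
      then have "N (S t f) \<le> M * N f" using M(3) Suc.prems by simp
      also have "\<dots> \<le> M ^ Suc (Suc n) * N f"
        using M(2) N_nonneg[OF Suc.prems(2)] power_increasing[of 1 "Suc (Suc n)" M]
        by (intro mult_right_mono) auto
      finally show ?thesis .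
    next
      case False
      then have t: "t - \<delta> \<in> {0..real (Suc n) * \<delta>}" using Suc.prems by (auto simp: algebra_simps)
      have "S t f = S \<delta> (S (t - \<delta>) f)"
        using S_S[of \<delta> "t - \<delta>" f] False M(1) Suc.prems by simp
      then have "N (S t f) \<le> M * N (S (t - \<delta>) f)"
        using M(1) M(3)[of \<delta> "S (t - \<delta>) f"] S_mem[of "t - \<delta>" f] t Suc.prems by simp
      also have "\<dots> \<le> M * (M ^ Suc n * N f)"
        using M(2) Suc.IH[OF t Suc.prems(2)] by (intro mult_left_mono) auto
      finally show ?thesis by (simp add: mult.assoc)
    qed
  qed
  obtain n where "T / \<delta> < real n" using reals_Archimedean2 by blast
  then have "T < real n * \<delta>" using M(1) by (simp add: divide_less_eq)
  also have "\<dots> \<le> real (Suc n) * \<delta>" using M(1) by (intro mult_right_mono) auto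
  finally have "{0..T} \<subseteq> {0..real (Suc n) * \<delta>}" by auto
  then show ?thesis
    using step M(2) by (intro that[of "M ^ Suc n"]) (auto intro: one_le_power simp del: power_Suc)
qed

text \<open>
  For \<open>s < t\<close> the increment is \<open>S s\<close> applied to \<open>S (t - s) f - f\<close>. Boundedness of the operators on
  compact time intervals turns right continuity at 0 into uniform continuity.
\<close>

lemma orbit_uniformly_continuous:
  assumes f: "f \<in> X" and a: "0 \<le> a"
  shows "N_uniformly_continuous T (\<lambda>s. S (a + s) f)"
  unfolding N_uniformly_continuous_def
proof (intro conjI ballI allI impI)
  show "S (a + s) f \<in> X" if "s \<in> {0..T}" for s using that a by (auto intro: S_mem f)
  fix e :: real assume e: "0 < e"
  obtain M where M: "1 \<le> M" "\<And>t f. t \<in> {0..a + T} \<Longrightarrow> f \<in> X \<Longrightarrow> N (S t f) \<le> M * N f"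
    by (rule bounded_on_compact_time[of "a + T"]) blast
  have "eventually (\<lambda>t. N (\<lambda>z. S t f z - f z) < e / M) (at_right 0)"
    using order_tendstoD(2)[OF right_continuous_at_0[OF f]] e M by simp
  then obtain d where d: "0 < d" "\<And>t. 0 < t \<Longrightarrow> t < d \<Longrightarrow> N (\<lambda>z. S t f z - f z) < e / M"
    unfolding eventually_at_right_field by auto
  have main: "N (\<lambda>z. S (a + t) f z - S (a + s) f z) < e" if st: "0 \<le> s" "s < t" "t \<le> T" "t - s < d" for s t
  proof -
    have mem: "S (t - s) f \<in> X" using st f by (auto intro: S_mem)
    have "S (a + s) (\<lambda>z. S (t - s) f z - f z) = (\<lambda>z. S (a + t) f z - S (a + s) f z)"
      using S_diff[of "a + s" "S (t - s) f" f] S_S[of "a + s" "t - s" f] mem st f a by simp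
    then have "N (\<lambda>z. S (a + t) f z - S (a + s) f z) \<le> M * N (\<lambda>z. S (t - s) f z - f z)"
      using M(2)[of "a + s", OF _ diff_mem[OF mem f]] st a by simp
    also have "\<dots> < M * (e / M)"
      using d(2)[of "t - s"] st M(1) by (intro mult_strict_left_mono) auto
    finally show ?thesis using M(1) by simp
  qed
  have "N (\<lambda>z. S (a + s) f z - S (a + t) f z) < e"
    if st: "s \<in> {0..T}" "t \<in> {0..T}" "\<bar>s - t\<bar> < d" for s t
  proof (cases s t rule: linorder_cases)
    case less
    then show ?thesis
      using main[of s t] N_minus_commute[of "S (a + s) f" "S (a + t) f"] st S_mem[of _ f] f a by auto
  next
    case equal
    then show ?thesis using e N_zero by simp
  next
    case greater
    then show ?thesis using main[of t s] st by auto
  qed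
  then show "\<exists>d>0. \<forall>s\<in>{0..T}. \<forall>t\<in>{0..T}. \<bar>s - t\<bar> < d \<longrightarrow> N (\<lambda>z. S (a + s) f z - S (a + t) f z) < e"
    using d(1) by blast
qed

definition orbit_integral :: "(complex \<Rightarrow> complex) \<Rightarrow> real \<Rightarrow> complex \<Rightarrow> complex" where
  "orbit_integral f t = (\<lambda>z. integral {0..t} (\<lambda>s. S s f z))"

lemma orbit_pointwise_continuous: "f \<in> X \<Longrightarrow> continuous_on {0..T} (\<lambda>s. S s f z)"
  using N_uniformly_continuous_imp_pointwise[OF orbit_uniformly_continuous[of f 0]] by simp

lemma orbit_integral_mem: "f \<in> X \<Longrightarrow> 0 \<le> t \<Longrightarrow> orbit_integral f t \<in> X"
  unfolding orbit_integral_def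
  using integral_mem_and_Riemann_limit(1)[OF _ orbit_uniformly_continuous[of f 0]] by simp

lemma S_Riemann_sum:
  assumes "0 \<le> h" "\<And>s. s \<in> {0..T} \<Longrightarrow> c s \<in> X" "0 \<le> T"
  shows "S h (Riemann_sum c T n) = Riemann_sum (\<lambda>s. S h (c s)) T n"
proof -
  have "c (real k * T / real n) \<in> X" if "k < n" for k
    using assms node_in_interval[OF assms(3) that] by blast
  then show ?thesis
    unfolding Riemann_sum_def
    using S_scale[OF assms(1) sum_mem[of "{..<n}" "\<lambda>k. c (real k * T / real n)"], of "complex_of_real (T / real n)"]
      S_sum[OF assms(1), of "{..<n}" "\<lambda>k. c (real k * T / real n)"]
    by simp
qed

text \<open>
  A bounded operator commutes with Riemann sums and with norm limits, hence with the integral.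
\<close>

lemma S_orbit_integral:
  assumes f: "f \<in> X" and t: "0 \<le> t" and h: "0 \<le> h"
  shows "S h (orbit_integral f t) z = integral {0..t} (\<lambda>s. S (h + s) f z)"
proof -
  let ?V = "orbit_integral f t"
  let ?R = "\<lambda>n. Riemann_sum (\<lambda>s. S s f) t (Suc n)"
  note uc = orbit_uniformly_continuous[OF f]
  have V: "?V \<in> X" by (rule orbit_integral_mem[OF f t])
  have Rm: "?R n \<in> X" for n using f t by (intro Riemann_sum_mem S_mem) auto
  have lim: "(\<lambda>n. N (\<lambda>z. ?R n z - ?V z)) \<longlonglongrightarrow> 0"
    using integral_mem_and_Riemann_limit(2)[OF t uc[of 0]] by (simp add: orbit_integral_def)
  obtain C where C: "0 < C" "\<And>f. f \<in> X \<Longrightarrow> N (S h f) \<le> C * N f"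
    using S_bounded[OF h] by blast
  have "(\<lambda>n. N (\<lambda>z. S h (?R n) z - S h ?V z)) \<longlonglongrightarrow> 0"
  proof (rule real_tendsto_sandwich)
    show "eventually (\<lambda>n. 0 \<le> N (\<lambda>z. S h (?R n) z - S h ?V z)) sequentially"
      by (intro always_eventually allI N_nonneg diff_mem S_mem h Rm V)
    show "eventually (\<lambda>n. N (\<lambda>z. S h (?R n) z - S h ?V z) \<le> C * N (\<lambda>z. ?R n z - ?V z)) sequentially"
      using C(2)[OF diff_mem[OF Rm V]] S_diff[OF h Rm V] by simp
    show "(\<lambda>n. C * N (\<lambda>z. ?R n z - ?V z)) \<longlonglongrightarrow> 0"
      by (rule tendsto_mult_right_zero[OF lim])
  qed auto
  then have 1: "(\<lambda>n. S h (?R n) z) \<longlonglongrightarrow> S h ?V z"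
    by (intro N_convergence_imp_pointwise S_mem h Rm V)
  have "S h (?R n) = Riemann_sum (\<lambda>s. S (h + s) f) t (Suc n)" for n
  proof -
    have "S h (?R n) = Riemann_sum (\<lambda>s. S h (S s f)) t (Suc n)"
      using f t h by (intro S_Riemann_sum S_mem) auto
    also have "\<dots> = Riemann_sum (\<lambda>s. S (h + s) f) t (Suc n)"
      unfolding Riemann_sum_def using f h t by (intro ext) (simp add: S_S)
    finally show ?thesis .
  qed
  then have "(\<lambda>n. S h (?R n) z) \<longlonglongrightarrow> integral {0..t} (\<lambda>s. S (h + s) f z)"
    using N_convergence_imp_pointwise[OF _ integral_mem_and_Riemann_limit[OF t uc[OF h]], of z]
    using Rm S_mem[OF h Rm] by simp
  then show ?thesis using 1 LIMSEQ_unique by blast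
qed

text \<open>
  The fundamental theorem of calculus at the left endpoint, in the norm of the space: the mean of an orbit
  over a short interval converges to its initial value.
\<close>

lemma orbit_increment_estimate:
  assumes f: "f \<in> X" and a: "0 \<le> a" and e: "0 < e"
  shows "eventually (\<lambda>h. (\<lambda>z. integral {0..h} (\<lambda>s. S (a + s) f z) - of_real h * S a f z) \<in> X \<and>
    N (\<lambda>z. integral {0..h} (\<lambda>s. S (a + s) f z) - of_real h * S a f z) \<le> h * e) (at_right 0)"
proof -
  obtain d where d: "0 < d" "\<And>s t. s \<in> {0..1} \<Longrightarrow> t \<in> {0..1} \<Longrightarrow> \<bar>s - t\<bar> < d \<Longrightarrow>
      N (\<lambda>z. S (a + s) f z - S (a + t) f z) < e"
    by (rule N_uniformly_continuousE[OF orbit_uniformly_continuous[OF f a, of 1] e]) blast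
  have Sa: "S a f \<in> X" by (rule S_mem[OF a f])
  have "(\<lambda>z. integral {0..h} (\<lambda>s. S (a + s) f z) - of_real h * S a f z) \<in> X \<and>
    N (\<lambda>z. integral {0..h} (\<lambda>s. S (a + s) f z) - of_real h * S a f z) \<le> h * e"
    if h: "0 < h" "h < min d 1" for h
  proof -
    define c where "c s = (\<lambda>z. S (a + s) f z - S a f z)" for s
    have c: "N_uniformly_continuous h c"
    proof -
      have "(\<lambda>z. c s z - c t z) = (\<lambda>z. S (a + s) f z - S (a + t) f z)" for s t
        by (simp add: c_def)
      moreover have "c s \<in> X" if "s \<in> {0..h}" for s
        unfolding c_def using that a by (intro diff_mem Sa S_mem f) auto
      ultimately show ?thesis
        using orbit_uniformly_continuous[OF f a, of h] unfolding N_uniformly_continuous_def by simp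
    qed
    have I: "integral {0..h} (\<lambda>s. c s z) = integral {0..h} (\<lambda>s. S (a + s) f z) - of_real h * S a f z" for z
    proof -
      have "(\<lambda>s. S (a + s) f z) integrable_on {0..h}"
        by (intro integrable_continuous_interval N_uniformly_continuous_imp_pointwise orbit_uniformly_continuous f a)
      then show ?thesis
        unfolding c_def using h by (subst integral_diff) (auto simp: scaleR_conv_of_real)
    qed
    have "N (c s) \<le> e" if "s \<in> {0..h}" for s
      using d(2)[of s 0] that h by (auto simp: c_def)
    then have "N (\<lambda>z. integral {0..h} (\<lambda>s. c s z)) \<le> h * e"
      using h c by (intro N_integral_le) auto
    moreover have "(\<lambda>z. integral {0..h} (\<lambda>s. c s z)) \<in> X"
      using h c by (intro integral_mem_and_Riemann_limit(1)) auto
    ultimately show ?thesis unfolding I by blast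
  qed
  then show ?thesis
    unfolding eventually_at_right_field using d(1) by (intro exI[of _ "min d 1"]) auto
qed

lemma orbit_integral_increment:
  assumes f: "f \<in> X" and t: "0 \<le> t" and h: "0 \<le> h"
  shows "S h (orbit_integral f t) z - orbit_integral f t z =
    integral {0..h} (\<lambda>s. S (t + s) f z) - integral {0..h} (\<lambda>s. S s f z)"
proof -
  define F where "F x = integral {0..x} (\<lambda>s. S s f z)" for x
  have shift: "integral {0..b} (\<lambda>s. S (a + s) f z) = F (a + b) - F a" if "0 \<le> a" "0 \<le> b" for a b
  proof -
    have int: "(\<lambda>s. S s f z) integrable_on {0..a + b}"
      by (intro integrable_continuous_interval orbit_pointwise_continuous f)
    have "integral {0..b} (\<lambda>s. S (a + s) f z) = integral {a..a + b} (\<lambda>s. S s f z)"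
      using integral_shift_Icc_real[of 0 b "\<lambda>s. S s f z" a] by (simp add: o_def add.commute)
    also have "\<dots> = F (a + b) - F a"
      unfolding F_def using Henstock_Kurzweil_Integration.integral_combine[OF that(1) _ int] that
      by (simp add: algebra_simps)
    finally show ?thesis .
  qed
  show ?thesis
    using S_orbit_integral[OF f t h, of z] shift[OF h t] shift[OF t h]
    by (simp add: F_def orbit_integral_def algebra_simps)
qed

text \<open>
  By the semigroup law, \<open>S h\<close> shifts the integration interval, so that only the two short end pieces
  remain in the increment; \<open>orbit_increment_estimate\<close> gives their limits.
\<close>

lemma orbit_integral_in_domain:
  assumes f: "f \<in> X" and t: "0 \<le> t"
  shows "diff_quotient_limit X N S (orbit_integral f t) (\<lambda>z. S t f z - f z)"
  unfolding diff_quotient_limit_def limitin_norm_iff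
proof (intro conjI)
  let ?V = "orbit_integral f t" and ?Q = "\<lambda>h z. (S h (orbit_integral f t) z - orbit_integral f t z) / complex_of_real h"
  let ?l = "\<lambda>z. S t f z - f z"
  show l: "?l \<in> X" by (intro diff_mem S_mem t f)
  have V: "?V \<in> X" by (rule orbit_integral_mem[OF f t])
  have Q: "?Q h \<in> X" if "0 < h" for h
    using scale_mem[OF diff_mem[OF S_mem[OF less_imp_le[OF that] V] V], of "1 / complex_of_real h"] by simp
  show "eventually (\<lambda>h. ?Q h \<in> X) (at_right 0)"
    using eventually_at_right_less[of 0] by eventually_elim (rule Q)
  show "((\<lambda>h. N (\<lambda>z. ?Q h z - ?l z)) \<longlongrightarrow> 0) (at_right 0)"
  proof (rule tendstoI)
    fix e :: real assume e: "0 < e"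
    let ?D = "\<lambda>a h z. integral {0..h} (\<lambda>s. S (a + s) f z) - complex_of_real h * S a f z"
    have e3: "0 < e / 3" using e by simp
    show "eventually (\<lambda>h. dist (N (\<lambda>z. ?Q h z - ?l z)) 0 < e) (at_right 0)"
      using orbit_increment_estimate[OF f t e3] orbit_increment_estimate[OF f order_refl e3] eventually_at_right_less[of 0]
    proof eventually_elim
      case (elim h)
      have eq: "(\<lambda>z. ?Q h z - ?l z) = (\<lambda>z. complex_of_real (1 / h) * (?D t h z - ?D 0 h z))"
        using orbit_integral_increment[OF f t, of h] S_0[OF f] elim(3)
        by (intro ext) (simp add: field_simps)
      moreover have "N (\<lambda>z. complex_of_real (1 / h) * (?D t h z - ?D 0 h z)) = 1 / h * N (\<lambda>z. ?D t h z - ?D 0 h z)"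
        using elim by (intro N_scale_real diff_mem[of "?D t h" "?D 0 h"]) auto
      moreover have "N (\<lambda>z. ?D t h z - ?D 0 h z) \<le> N (?D t h) + N (?D 0 h)"
        using elim by (intro N_diff_le[of "?D t h" "?D 0 h"]) auto
      then have "N (\<lambda>z. ?D t h z - ?D 0 h z) \<le> h * (e / 3) + h * (e / 3)"
        using elim by linarith
      then have "1 / h * N (\<lambda>z. ?D t h z - ?D 0 h z) \<le> 1 / h * (h * (e / 3) + h * (e / 3))"
        using elim by (intro mult_left_mono) auto
      moreover have "1 / h * (h * (e / 3) + h * (e / 3)) < e" using elim e by (simp add: field_simps)
      ultimately have "N (\<lambda>z. ?Q h z - ?l z) < e" unfolding eq by linarith
      then show ?case using N_nonneg[OF diff_mem[OF Q[OF elim(3)] l]] by (simp add: dist_real_def)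
    qed
  qed
qed

end

context analytic_semigroup
begin

lemma N_orbit_difference_continuous:
  assumes f: "f \<in> X" and a: "0 \<le> a"
  shows "continuous_on {0..} (\<lambda>t. N (\<lambda>z. S t f z - S a f z))"
  unfolding continuous_on_iff
proof (intro ballI allI impI)
  fix t e :: real assume t: "t \<in> {0..}" and e: "0 < e"
  obtain d where d: "0 < d"
    "\<And>s u. s \<in> {0..t + 1} \<Longrightarrow> u \<in> {0..t + 1} \<Longrightarrow> \<bar>s - u\<bar> < d \<Longrightarrow> N (\<lambda>z. S (0 + s) f z - S (0 + u) f z) < e"
    by (rule N_uniformly_continuousE[OF orbit_uniformly_continuous[OF f order_refl, of "t + 1"] e]) blast
  show "\<exists>d>0. \<forall>s\<in>{0..}. dist s t < d \<longrightarrow>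
      dist (N (\<lambda>z. S s f z - S a f z)) (N (\<lambda>z. S t f z - S a f z)) < e"
  proof (intro exI[of _ "min d 1"] conjI ballI impI)
    fix s assume s: "s \<in> {0..}" "dist s t < min d 1"
    have mem: "S s f \<in> X" "S t f \<in> X" "S a f \<in> X" using s t a by (auto intro: S_mem f)
    have "N (\<lambda>z. S s f z - S t f z) < e"
      using d(2)[of s t] s t by (auto simp: dist_real_def)
    then show "dist (N (\<lambda>z. S s f z - S a f z)) (N (\<lambda>z. S t f z - S a f z)) < e"
      using N_diff_triangle[OF mem] N_diff_triangle[OF mem(2,1,3)] N_minus_commute[OF mem(1,2)]
      by (simp add: dist_real_def)
  qed (use d in auto)
qed

text \<open>
  On a compact neighbourhood of the point the values of \<open>S t f - S a f\<close> are controlled by its norm, uniformly in \<open>z\<close>.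
\<close>

lemma orbit_jointly_continuous:
  assumes f: "f \<in> X"
  shows "continuous_on ({0..} \<times> unit_disc) (\<lambda>(t, z). S t f z)"
  unfolding continuous_on_def
proof (intro ballI)
  fix p :: "real \<times> complex" assume "p \<in> {0..} \<times> unit_disc"
  then obtain a w where p: "p = (a, w)" "0 \<le> a" "w \<in> unit_disc" by auto
  let ?A = "{0..} \<times> unit_disc :: (real \<times> complex) set"
  obtain r where r: "0 < r" "cball w r \<subseteq> unit_disc"
    using p(3) open_contains_cball by blast
  obtain C where C: "0 < C" "\<And>f z. f \<in> X \<Longrightarrow> z \<in> cball w r \<Longrightarrow> cmod (f z) \<le> C * N f"
    by (rule N_bounds_sup_on_compact[OF compact_cball r(2)]) blast
  have Sa: "S a f \<in> X" using p f by (auto intro: S_mem)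
  have "((\<lambda>q. S (fst q) f (snd q) - S a f (snd q)) \<longlongrightarrow> 0) (at p within ?A)"
  proof (rule Lim_null_comparison)
    have "open (UNIV \<times> ball w r :: (real \<times> complex) set)" "p \<in> UNIV \<times> ball w r"
      using r p by (auto intro: open_Times)
    then have "eventually (\<lambda>q. q \<in> UNIV \<times> ball w r) (at p within ?A)"
      using eventually_at_topological by blast
    moreover have "eventually (\<lambda>q. q \<in> ?A) (at p within ?A)"
      by (auto simp: eventually_at_filter)
    ultimately show "eventually (\<lambda>q. cmod (S (fst q) f (snd q) - S a f (snd q)) \<le>
        C * N (\<lambda>z. S (fst q) f z - S a f z)) (at p within ?A)"
    proof eventually_elim
      case (elim q)
      then have "S (fst q) f \<in> X" "snd q \<in> cball w r" by (auto intro: S_mem f)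
      then show ?case by (intro C(2)[of "\<lambda>z. S (fst q) f z - S a f z"] diff_mem Sa)
    qed
    have "continuous_on ?A (\<lambda>q. N (\<lambda>z. S (fst q) f z - S a f z))"
      by (rule continuous_on_compose2[OF N_orbit_difference_continuous[OF f p(2)]])
         (auto intro!: continuous_intros)
    then have "((\<lambda>q. N (\<lambda>z. S (fst q) f z - S a f z)) \<longlongrightarrow> N (\<lambda>z. S a f z - S a f z)) (at p within ?A)"
      using p unfolding continuous_on_def by force
    then show "((\<lambda>q. C * N (\<lambda>z. S (fst q) f z - S a f z)) \<longlongrightarrow> 0) (at p within ?A)"
      using N_zero by (intro tendsto_mult_right_zero) simp
  qed
  moreover have "((\<lambda>q. S a f (snd q)) \<longlongrightarrow> S a f w) (at p within ?A)"
  proof -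
    have "continuous_on ?A (\<lambda>q. S a f (snd q))"
      by (rule continuous_on_compose2[OF holomorphic_on_imp_continuous_on[OF holomorphic[OF Sa]]])
         (auto intro!: continuous_intros)
    then show ?thesis using p unfolding continuous_on_def by force
  qed
  ultimately have "((\<lambda>q. S (fst q) f (snd q)) \<longlongrightarrow> S a f w) (at p within ?A)"
    using tendsto_add[of "\<lambda>q. S (fst q) f (snd q) - S a f (snd q)" 0 "at p within ?A" "\<lambda>q. S a f (snd q)" "S a f w"]
    by simp
  then show "((\<lambda>(t, z). S t f z) \<longlongrightarrow> (case p of (t, z) \<Rightarrow> S t f z)) (at p within ?A)"
    by (simp add: p case_prod_beta')
qed

text \<open>
  In the space variable holomorphy at a single time suffices, because the time derivative is jointly continuous.
\<close>

lemma orbit_integral_total_derivative: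
  assumes f: "f \<in> X" and z: "z \<in> unit_disc" and t: "t \<in> {0..T}"
  shows "((\<lambda>(z, t). orbit_integral f t z) has_derivative
    (\<lambda>(a, b). deriv (orbit_integral f t) z * a + b *\<^sub>R S t f z)) (at (z, t) within unit_disc \<times> {0..T})"
proof -
  have "orbit_integral f t holomorphic_on unit_disc"
    using t f by (intro holomorphic orbit_integral_mem) auto
  then have "(orbit_integral f t has_field_derivative deriv (orbit_integral f t) z) (at z)"
    using z by (meson holomorphic_derivI open_ball)
  then have dz: "((\<lambda>z. orbit_integral f t z) has_derivative (\<lambda>a. deriv (orbit_integral f t) z * a)) (at z within unit_disc)"
    unfolding has_field_derivative_def by (rule has_derivative_at_withinI)
  have dt: "((\<lambda>t. orbit_integral f t w) has_derivative blinfun_apply (blinfun_scaleR_left (S s f w))) (at s within {0..T})"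
    if "s \<in> {0..T}" for s w
    using integral_has_vector_derivative[OF orbit_pointwise_continuous[OF f] that, of w]
    unfolding orbit_integral_def has_vector_derivative_def by simp
  have cont: "continuous (at (z, t) within unit_disc \<times> {0..T}) (\<lambda>(w, s). blinfun_scaleR_left (S s f w))"
  proof -
    have "continuous_on (unit_disc \<times> {0..T}) (\<lambda>q. (\<lambda>(t, z). S t f z) (snd q, fst q))"
      by (rule continuous_on_compose2[OF orbit_jointly_continuous[OF f]])
         (auto intro!: continuous_intros)
    then have "continuous_on (unit_disc \<times> {0..T}) (\<lambda>q. blinfun_scaleR_left (S (snd q) f (fst q)))"
      by (intro bounded_linear.continuous_on[OF bounded_linear_blinfun_scaleR_left]) simp
    then show ?thesis
      using z t by (simp add: continuous_on_eq_continuous_within case_prod_beta')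
  qed
  show ?thesis
    using has_derivative_partialsI[OF dz dt cont t] by (simp add: case_prod_beta')
qed

end

section \<open>Characteristics of the generator\<close>

locale weighted_generator = analytic_semigroup +
  fixes G g :: "complex \<Rightarrow> complex"
  assumes G: "G holomorphic_on unit_disc" and g: "g holomorphic_on unit_disc"
    and gen: "\<And>f. f \<in> generator_domain X N S \<Longrightarrow> generator X N S f = first_order_expr G g f"
begin

text \<open>
  The integrated orbit lies in the domain of the generator for every \<open>f\<close>. Evaluating the generator on it in
  the two available ways gives a first order equation that holds pointwise, with \<open>S t f\<close> as its time derivative.
\<close>

lemma integrated_equation:
  assumes f: "f \<in> X" and t: "0 \<le> t" and z: "z \<in> unit_disc"
  shows "S t f z - f z = G z * deriv (orbit_integral f t) z + g z * orbit_integral f t z"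
proof -
  let ?V = "orbit_integral f t"
  note lim = orbit_integral_in_domain[OF f t]
  have "?V \<in> generator_domain X N S"
    using lim orbit_integral_mem[OF f t] by (auto simp: generator_domain_def)
  then have "generator X N S ?V = first_order_expr G g ?V" by (rule gen)
  moreover have "generator X N S ?V = (\<lambda>z. S t f z - f z)"
    unfolding generator_def
  proof (rule the_equality)
    show "diff_quotient_limit X N S ?V (\<lambda>z. S t f z - f z)" by (rule lim)
    fix h assume "diff_quotient_limit X N S ?V h"
    then show "h = (\<lambda>z. S t f z - f z)"
      using lim unfolding diff_quotient_limit_def mtopology_eq[symmetric]
      by (rule limitin_metric_unique) simp
  qed
  ultimately have "(\<lambda>z. S t f z - f z) = first_order_expr G g ?V" by simp
  from fun_cong[OF this, of z] show ?thesis
    using z by (simp add: first_order_expr_def zero_ext_def)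
qed

text \<open>
  Following the characteristic forward while the time argument of the integrated orbit runs backward, the
  contributions of \<open>G\<close> and \<open>g\<close> cancel against the time derivative, and only the inhomogeneity \<open>f\<close> remains.
\<close>

lemma integrated_characteristic:
  assumes \<zeta>: "ode_solution G unit_disc \<zeta> T" and t: "t \<in> {0..T}" and f: "f \<in> X"
  shows "orbit_integral f t (\<zeta> 0) =
    integral {0..t} (\<lambda>s. f (\<zeta> s) * exp (integral {0..s} (\<lambda>r. g (\<zeta> r))))"
proof -
  define E where "E s = exp (integral {0..s} (\<lambda>r. g (\<zeta> r)))" for s
  define V where "V = orbit_integral f"
  have sol: "\<zeta> s \<in> unit_disc" "(\<zeta> has_vector_derivative G (\<zeta> s)) (at s within {0..t})" if "s \<in> {0..t}" for s
  proof -
    have "ode_solution G unit_disc \<zeta> t" using ode_solution_subinterval[OF \<zeta>] t by simp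
    then show "\<zeta> s \<in> unit_disc" "(\<zeta> has_vector_derivative G (\<zeta> s)) (at s within {0..t})"
      using that by (auto simp: ode_solution_def)
  qed
  have cont\<zeta>: "continuous_on {0..t} \<zeta>"
    using ode_solution_continuous[OF \<zeta>] t by (auto intro: continuous_on_subset)
  have contg: "continuous_on {0..t} (\<lambda>r. g (\<zeta> r))"
    by (rule continuous_on_compose2[OF holomorphic_on_imp_continuous_on[OF g] cont\<zeta>]) (use sol in auto)
  have contf: "continuous_on {0..t} (\<lambda>r. f (\<zeta> r))"
    by (rule continuous_on_compose2[OF holomorphic_on_imp_continuous_on[OF holomorphic[OF f]] cont\<zeta>]) (use sol in auto)
  have dE: "(E has_vector_derivative g (\<zeta> s) * E s) (at s within {0..t})" if "s \<in> {0..t}" for s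
    using field_vector_diff_chain_within[OF integral_has_vector_derivative[OF contg that]
        DERIV_subset[OF DERIV_exp subset_UNIV]]
    by (simp add: o_def E_def[abs_def])
  have contE: "continuous_on {0..t} E"
    unfolding continuous_on_eq_continuous_within
    by (intro ballI has_vector_derivative_continuous[OF dE])
  (* W is constant; its value at 0 is the left hand side, its value at t the right hand side. *)
  define W where "W s = V (t - s) (\<zeta> s) * E s + integral {0..s} (\<lambda>r. f (\<zeta> r) * E r)" for s
  have dW: "(W has_vector_derivative 0) (at s within {0..t})" if s: "s \<in> {0..t}" for s
  proof -
    let ?V' = "deriv (V (t - s)) (\<zeta> s)"
    have ts: "t - s \<in> {0..t}" using s by auto
    have inner: "((\<lambda>s. (\<zeta> s, t - s)) has_derivative (\<lambda>h. (h *\<^sub>R G (\<zeta> s), - h))) (at s within {0..t})"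
      using sol(2)[OF s] has_derivative_diff[OF has_derivative_const[of t] has_derivative_ident[of "at s within {0..t}"]]
      unfolding has_vector_derivative_def by (intro has_derivative_Pair) simp_all
    have "((\<lambda>(z, t). V t z) has_derivative (\<lambda>(a, b). ?V' * a + b *\<^sub>R S (t - s) f (\<zeta> s)))
        (at (\<zeta> s, t - s) within unit_disc \<times> {0..t})"
      unfolding V_def by (rule orbit_integral_total_derivative[OF f sol(1)[OF s] ts])
    then have outer: "((\<lambda>(z, t). V t z) has_derivative (\<lambda>(a, b). ?V' * a + b *\<^sub>R S (t - s) f (\<zeta> s)))
        (at (\<zeta> s, t - s) within (\<lambda>s. (\<zeta> s, t - s)) ` {0..t})"
      by (rule has_derivative_subset) (use sol in auto)
    have "((\<lambda>s. V (t - s) (\<zeta> s)) has_derivative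
        (\<lambda>h. ?V' * (h *\<^sub>R G (\<zeta> s)) + (- h) *\<^sub>R S (t - s) f (\<zeta> s))) (at s within {0..t})"
      using has_derivative_in_compose[OF inner outer] by simp
    then have dV: "((\<lambda>s. V (t - s) (\<zeta> s)) has_vector_derivative (G (\<zeta> s) * ?V' - S (t - s) f (\<zeta> s))) (at s within {0..t})"
      unfolding has_vector_derivative_def
      by (rule has_derivative_eq_rhs) (simp add: fun_eq_iff algebra_simps scaleR_conv_of_real)
    have "(W has_vector_derivative (V (t - s) (\<zeta> s) * (g (\<zeta> s) * E s) + (G (\<zeta> s) * ?V' - S (t - s) f (\<zeta> s)) * E s)
        + f (\<zeta> s) * E s) (at s within {0..t})"
      unfolding W_def[abs_def]
      by (intro has_vector_derivative_add has_vector_derivative_mult dV dE s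
          integral_has_vector_derivative continuous_on_mult contf contE)
    moreover have "S (t - s) f (\<zeta> s) = f (\<zeta> s) + (G (\<zeta> s) * ?V' + g (\<zeta> s) * V (t - s) (\<zeta> s))"
      unfolding V_def using integrated_equation[OF f _ sol(1)[OF s], of "t - s"] s by (simp add: algebra_simps)
    then have "V (t - s) (\<zeta> s) * (g (\<zeta> s) * E s) + (G (\<zeta> s) * ?V' - S (t - s) f (\<zeta> s)) * E s + f (\<zeta> s) * E s = 0"
      by (simp add: algebra_simps)
    ultimately show ?thesis by simp
  qed
  have "W 0 = W t"
  proof (rule has_vector_derivative_zero_constant[OF convex_real_interval(5) dW])
    fix c assume "\<And>s. s \<in> {0..t} \<Longrightarrow> W s = c"
    then show "W 0 = W t" using t by simp
  qed
  then show ?thesis using t by (simp add: W_def V_def orbit_integral_def E_def)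
qed

text \<open>
  The derivative in \<open>t\<close> of \<open>integrated_characteristic\<close>. It implies that solutions are unique: applied to the functions 1 and \<open>z\<close> it expresses \<open>\<zeta> t\<close> through the
  semigroup and the starting point.
\<close>

lemma characteristic_formula:
  assumes \<zeta>: "ode_solution G unit_disc \<zeta> T" and T: "0 < T" and t: "t \<in> {0..T}" and f: "f \<in> X"
  shows "S t f (\<zeta> 0) = exp (integral {0..t} (\<lambda>r. g (\<zeta> r))) * f (\<zeta> t)"
proof -
  define E where "E s = exp (integral {0..s} (\<lambda>r. g (\<zeta> r)))" for s
  have in_disc: "\<zeta> s \<in> unit_disc" if "s \<in> {0..T}" for s using \<zeta> that by (simp add: ode_solution_def)
  note cont\<zeta> = ode_solution_continuous[OF \<zeta>]
  have contg: "continuous_on {0..T} (\<lambda>r. g (\<zeta> r))"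
    by (rule continuous_on_compose2[OF holomorphic_on_imp_continuous_on[OF g] cont\<zeta>]) (use in_disc in auto)
  have contf: "continuous_on {0..T} (\<lambda>r. f (\<zeta> r))"
    by (rule continuous_on_compose2[OF holomorphic_on_imp_continuous_on[OF holomorphic[OF f]] cont\<zeta>]) (use in_disc in auto)
  have contE: "continuous_on {0..T} E"
    unfolding E_def[abs_def]
    by (intro continuous_intros indefinite_integral_continuous_1 integrable_continuous_interval contg)
  have "((\<lambda>s. orbit_integral f s (\<zeta> 0)) has_vector_derivative S t f (\<zeta> 0)) (at t within {0..T})"
    unfolding orbit_integral_def by (rule integral_has_vector_derivative[OF orbit_pointwise_continuous[OF f] t])
  moreover have "((\<lambda>s. orbit_integral f s (\<zeta> 0)) has_vector_derivative f (\<zeta> t) * E t) (at t within {0..T})"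
  proof (rule has_vector_derivative_transform[OF t])
    show "orbit_integral f s (\<zeta> 0) = integral {0..s} (\<lambda>r. f (\<zeta> r) * E r)" if "s \<in> {0..T}" for s
      unfolding E_def by (rule integrated_characteristic[OF \<zeta> that f])
    show "((\<lambda>s. integral {0..s} (\<lambda>r. f (\<zeta> r) * E r)) has_vector_derivative f (\<zeta> t) * E t) (at t within {0..T})"
      by (intro integral_has_vector_derivative continuous_on_mult contf contE t)
  qed
  moreover have "at t within {0..T} \<noteq> bot"
    using T t by (simp add: trivial_limit_within islimpt_Icc)
  ultimately have "S t f (\<zeta> 0) = f (\<zeta> t) * E t"
    by (intro vector_derivative_unique_within)
  then show ?thesis by (simp add: E_def mult.commute)
qed

end

section \<open>Global existence of the flow\<close>

context weighted_generator
begin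

definition multiplier :: "real \<Rightarrow> complex \<Rightarrow> complex" where
  "multiplier t z = S t (disc_power 0) z"

text \<open>
  The quotient is defined before it is known to be a flow. It agrees with every solution of the differential
  equation for as long as that exists, and it is holomorphic wherever the denominator is not zero.
\<close>

definition flow :: "real \<Rightarrow> complex \<Rightarrow> complex" where
  "flow t z = S t (disc_power 1) z / S t (disc_power 0) z"

lemma disc_power_mem: "disc_power k \<in> X"
  by (rule disc_power_growth[of 2]) auto

lemma solution_is_flow:
  assumes \<zeta>: "ode_solution G unit_disc \<zeta> T" and T: "0 < T" and t: "t \<in> {0..T}"
  shows "multiplier t (\<zeta> 0) = exp (integral {0..t} (\<lambda>r. g (\<zeta> r)))"
    and "flow t (\<zeta> 0) = \<zeta> t"
    and "f \<in> X \<Longrightarrow> S t f (\<zeta> 0) = multiplier t (\<zeta> 0) * f (\<zeta> t)"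
proof -
  have "\<zeta> t \<in> unit_disc" using \<zeta> t by (simp add: ode_solution_def)
  note f = characteristic_formula[OF \<zeta> T t]
  show m: "multiplier t (\<zeta> 0) = exp (integral {0..t} (\<lambda>r. g (\<zeta> r)))"
    using f[OF disc_power_mem, of 0] \<open>\<zeta> t \<in> unit_disc\<close> by (simp add: multiplier_def disc_power_apply)
  show "flow t (\<zeta> 0) = \<zeta> t"
    using f[OF disc_power_mem, of 0] f[OF disc_power_mem, of 1] \<open>\<zeta> t \<in> unit_disc\<close>
    by (simp add: flow_def disc_power_apply)
  show "S t f (\<zeta> 0) = multiplier t (\<zeta> 0) * f (\<zeta> t)" if "f \<in> X"
    using f[OF that] m by simp
qed

text \<open>
  Only existence is asked for: by \<open>solution_is_flow\<close> the solution is necessarily \<open>\<lambda>t. flow t z\<close>.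
\<close>

definition lives :: "real \<Rightarrow> complex \<Rightarrow> bool" where
  "lives T z \<longleftrightarrow> (\<exists>\<zeta>. \<zeta> 0 = z \<and> ode_solution G unit_disc \<zeta> T)"

lemma livesD:
  assumes "lives T z" "0 < T"
  shows "ode_solution G unit_disc (\<lambda>t. flow t z) T" "flow 0 z = z"
    and "t \<in> {0..T} \<Longrightarrow> multiplier t z = exp (integral {0..t} (\<lambda>s. g (flow s z)))"
    and "t \<in> {0..T} \<Longrightarrow> flow t z \<in> unit_disc"
    and "t \<in> {0..T} \<Longrightarrow> f \<in> X \<Longrightarrow> S t f z = multiplier t z * f (flow t z)"
proof -
  obtain \<zeta> where \<zeta>: "\<zeta> 0 = z" "ode_solution G unit_disc \<zeta> T"
    using assms by (auto simp: lives_def)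
  have eq: "flow t z = \<zeta> t" if "t \<in> {0..T}" for t
    using solution_is_flow(2)[OF \<zeta>(2) assms(2) that] \<zeta>(1) by simp
  show sol: "ode_solution G unit_disc (\<lambda>t. flow t z) T"
    by (rule ode_solution_cong[OF \<zeta>(2) eq])
  show 0: "flow 0 z = z" using eq[of 0] \<zeta>(1) assms(2) by simp
  assume t: "t \<in> {0..T}"
  show "flow t z \<in> unit_disc" using sol t by (simp add: ode_solution_def)
  show "multiplier t z = exp (integral {0..t} (\<lambda>s. g (flow s z)))"
    using solution_is_flow(1)[OF sol assms(2) t] 0 by simp
  show "S t f z = multiplier t z * f (flow t z)" if "f \<in> X"
    using solution_is_flow(3)[OF sol assms(2) t that] 0 by simp
qed

lemma lives_mono: "lives T z \<Longrightarrow> T' \<le> T \<Longrightarrow> lives T' z"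
  unfolding lives_def using ode_solution_subinterval by blast

lemma lives_extend:
  assumes "lives T z" "0 < T" "lives T' (flow T z)" "0 < T'"
  shows "lives (T + T') z"
proof -
  let ?\<zeta> = "\<lambda>t. flow t z" and ?\<eta> = "\<lambda>t. flow t (flow T z)"
  have "ode_solution G unit_disc (\<lambda>t. if t \<in> {0..T} then ?\<zeta> t else ?\<eta> (t - T)) (T + T')"
    using assms livesD(1,2)[OF assms(1,2)] livesD(1,2)[OF assms(3,4)]
    by (intro ode_solution_concat) auto
  then show ?thesis
    unfolding lives_def using livesD(2)[OF assms(1,2)] assms(2)
    by (intro exI[of _ "\<lambda>t. if t \<in> {0..T} then ?\<zeta> t else ?\<eta> (t - T)"]) auto
qed

text \<open>
  For fixed \<open>t\<close>, \<open>flow t\<close> extends to a holomorphic self-map of the disc, whose value at 0 stays in a compact set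
  for \<open>t \<le> \<delta>\<close>. The Schwarz-Pick inequality bounds it on smaller discs, even at points where
  nothing is known yet about the solution starting there.
\<close>

lemma flow_stays_in_compact:
  assumes life: "\<And>z. z \<in> ball 0 (1/2) \<Longrightarrow> lives \<delta> z" and \<delta>: "0 < \<delta>" and r: "r < 1"
  obtains \<rho> where "r \<le> \<rho>" "\<rho> < 1"
    "\<And>t z. t \<in> {0..\<delta>} \<Longrightarrow> cmod z \<le> r \<Longrightarrow> multiplier t z \<noteq> 0 \<Longrightarrow> cmod (flow t z) \<le> \<rho>"
proof -
  have life0: "lives \<delta> 0" using life by simp
  have "continuous_on {0..\<delta>} (\<lambda>t. cmod (flow t 0))"
    by (intro continuous_on_norm ode_solution_continuous[OF livesD(1)[OF life0 \<delta>]])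
  then obtain s where s: "s \<in> {0..\<delta>}" "\<And>t. t \<in> {0..\<delta>} \<Longrightarrow> cmod (flow t 0) \<le> cmod (flow s 0)"
    using continuous_attains_sup[of "{0..\<delta>}" "\<lambda>t. cmod (flow t 0)"] \<delta> by fastforce
  define q where "q = cmod (flow s 0)"
  have q: "q < 1" using livesD(4)[OF life0 \<delta> s(1)] by (simp add: q_def)
  define \<kappa> where "\<kappa> = 1 - (1 - r\<^sup>2) * (1 - q)\<^sup>2"
  have bound: "(cmod (flow t z))\<^sup>2 \<le> \<kappa>" if t: "t \<in> {0..\<delta>}" and z: "cmod z \<le> r" and nz: "multiplier t z \<noteq> 0" for t z
  proof -
    have t0: "0 \<le> t" using t by simp
    have nz0: "S t (disc_power 0) 0 \<noteq> 0"
      using livesD(3)[OF life0 \<delta> t] by (simp add: multiplier_def)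
    obtain F where F: "F holomorphic_on ball 0 1" "F ` ball 0 1 \<subseteq> ball 0 1"
      "\<And>z. z \<in> ball 0 1 \<Longrightarrow> S t (disc_power 1) z = S t (disc_power 0) z * F z"
    proof (rule composition_symbol_from_powers[where U = "ball 0 (1/2)" and c = "\<lambda>k. S t (disc_power k)" and p = "flow t"])
      show "S t (disc_power k) holomorphic_on ball 0 1" for k
        by (intro holomorphic S_mem t0 disc_power_mem)
      show "S t (disc_power k) z = S t (disc_power 0) z * flow t z ^ k" if "z \<in> ball 0 (1/2)" for k z
        using livesD(5)[OF life[OF that] \<delta> t disc_power_mem[of k]] livesD(4)[OF life[OF that] \<delta> t]
        by (simp add: multiplier_def disc_power_apply)
      show "\<exists>C. \<forall>k. cmod (S t (disc_power k) z) \<le> C * R ^ k" if R: "1 < R" for R z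
      proof -
        obtain C where C: "\<And>k. N (disc_power k) \<le> C * R ^ k"
          by (rule disc_power_growth[OF R]) blast
        obtain A where A: "0 < A" "\<And>f. f \<in> X \<Longrightarrow> N (S t f) \<le> A * N f"
          using S_bounded[OF t0] by blast
        obtain B where B: "0 < B" "\<And>f. f \<in> X \<Longrightarrow> cmod (f z) \<le> B * N f"
          by (rule N_bounds_point[of z]) blast
        have "cmod (S t (disc_power k) z) \<le> (B * A * C) * R ^ k" for k
        proof -
          have "cmod (S t (disc_power k) z) \<le> B * N (S t (disc_power k))"
            by (intro B(2) S_mem t0 disc_power_mem)
          also have "\<dots> \<le> B * (A * N (disc_power k))"
            using B(1) A(2)[OF disc_power_mem] by (intro mult_left_mono) auto
          also have "\<dots> \<le> B * (A * (C * R ^ k))"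
            using A(1) B(1) C by (intro mult_left_mono) auto
          finally show ?thesis by (simp add: mult.assoc)
        qed
        then show ?thesis by blast
      qed
      show "cmod (flow t 0) < 1" using livesD(4)[OF life0 \<delta> t] by simp
    qed (use nz0 in auto)
    have Fflow: "F w = flow t w" if "w \<in> ball 0 1" "S t (disc_power 0) w \<noteq> 0" for w
      using F(3)[OF that(1)] that(2) by (simp add: flow_def)
    have "(cmod (F z))\<^sup>2 \<le> \<kappa>"
      unfolding \<kappa>_def using Fflow[of 0] nz0 s(2)[OF t] q r z
      by (intro Schwarz_Pick_bound F) (auto simp: q_def)
    then show ?thesis using Fflow[of z] nz z r by (simp add: multiplier_def)
  qed
  show ?thesis
  proof (cases "0 \<le> r")
    case False
    then have "\<not> cmod z \<le> r" for z by (metis norm_ge_zero order_trans)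
    then show ?thesis using that[of r] r by blast
  next
    case True
    have "r\<^sup>2 < 1" using True r by (simp add: power_less_one_iff abs_square_less_1)
    then have "0 < (1 - r\<^sup>2) * (1 - q)\<^sup>2" using q by (intro mult_pos_pos) auto
    then have "sqrt \<kappa> < 1" unfolding \<kappa>_def by simp
    show ?thesis
    proof (rule that[of "max r (sqrt \<kappa>)"])
      show "cmod (flow t z) \<le> max r (sqrt \<kappa>)" if "t \<in> {0..\<delta>}" "cmod z \<le> r" "multiplier t z \<noteq> 0" for t z
        using real_le_rsqrt[OF bound[OF that]] by simp
    qed (use r \<open>sqrt \<kappa> < 1\<close> in auto)
  qed
qed

lemma uniform_lifetime:
  assumes "r < 1"
  obtains \<delta> where "0 < \<delta>" "\<And>z. cmod z \<le> r \<Longrightarrow> lives \<delta> z"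
proof -
  have "cball 0 r \<subseteq> unit_disc" using assms by auto
  then obtain \<delta> where "0 < \<delta>" "\<And>z. z \<in> cball 0 r \<Longrightarrow> \<exists>\<zeta>. \<zeta> 0 = z \<and> ode_solution G unit_disc \<zeta> \<delta>"
    by (rule ode_uniform_local_existence[OF open_ball G compact_cball]) blast
  then show ?thesis by (intro that) (auto simp: lives_def)
qed

text \<open>
  A solution can be continued by a fixed time step for as long as it stays in a fixed compact set; up to the time
  \<open>\<delta>\<close> this is ensured by \<open>flow_stays_in_compact\<close>. Since every point of the disc then survives for the same time \<open>\<delta>\<close>,
  the solutions can be concatenated indefinitely.
\<close>

lemma lives_forever:
  assumes z: "z \<in> unit_disc"
  shows "lives T z"
proof -
  obtain \<delta> where \<delta>: "0 < \<delta>" "\<And>z. cmod z \<le> 1/2 \<Longrightarrow> lives \<delta> z"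
    by (rule uniform_lifetime[of "1/2"]) auto
  have step: "lives \<delta> z" if z: "z \<in> unit_disc" for z
  proof -
    have "cmod z < 1" using z by simp
    obtain \<rho> where \<rho>: "cmod z \<le> \<rho>" "\<rho> < 1"
      "\<And>t w. t \<in> {0..\<delta>} \<Longrightarrow> cmod w \<le> cmod z \<Longrightarrow> multiplier t w \<noteq> 0 \<Longrightarrow> cmod (flow t w) \<le> \<rho>"
      by (rule flow_stays_in_compact[OF \<delta>(2) \<delta>(1) \<open>cmod z < 1\<close>]) auto
    obtain \<delta>' where \<delta>': "0 < \<delta>'" "\<And>z. cmod z \<le> \<rho> \<Longrightarrow> lives \<delta>' z"
      by (rule uniform_lifetime[OF \<rho>(2)]) blast
    have "lives (min \<delta> (real (Suc n) * \<delta>')) z" for n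
    proof (induction n)
      case 0
      show ?case using \<delta>'(2)[OF \<rho>(1)] by (auto intro: lives_mono)
    next
      case (Suc n)
      let ?T = "min \<delta> (real (Suc n) * \<delta>')"
      have T: "0 < ?T" "?T \<in> {0..\<delta>}" using \<delta>(1) \<delta>'(1) by auto
      have "multiplier ?T z \<noteq> 0" using livesD(3)[OF Suc T(1), of ?T] T(1) by simp
      then have "lives \<delta>' (flow ?T z)" by (intro \<delta>'(2) \<rho>(3) T(2)) auto
      then have "lives (?T + \<delta>') z" by (intro lives_extend Suc T(1) \<delta>'(1))
      then show ?case
        by (rule lives_mono) (use \<delta>'(1) in \<open>auto simp: min_def algebra_simps\<close>)
    qed
    moreover obtain n where "\<delta> / \<delta>' < real n" using reals_Archimedean2 by blast
    then have "min \<delta> (real (Suc n) * \<delta>') = \<delta>" using \<delta>'(1) by (simp add: field_simps min_def)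
    ultimately show ?thesis by metis
  qed
  have "lives (real (Suc n) * \<delta>) z" for n
  proof (induction n)
    case 0
    show ?case using step[OF z] by simp
  next
    case (Suc n)
    have T: "0 < real (Suc n) * \<delta>" using \<delta>(1) by simp
    have "flow (real (Suc n) * \<delta>) z \<in> unit_disc"
      using livesD(4)[OF Suc T, of "real (Suc n) * \<delta>"] T by simp
    then have "lives (real (Suc n) * \<delta> + \<delta>) z"
      using lives_extend[OF Suc T step \<delta>(1)] by blast
    then show ?case by (simp add: algebra_simps)
  qed
  moreover obtain n where "T / \<delta> < real n" using reals_Archimedean2 by blast
  then have "T \<le> real (Suc n) * \<delta>" using \<delta>(1) by (simp add: field_simps)
  ultimately show ?thesis using lives_mono by blast
qed

lemma flow_solution: "z \<in> unit_disc \<Longrightarrow> 0 < T \<Longrightarrow> ode_solution G unit_disc (\<lambda>t. flow t z) T"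
  by (rule livesD(1)[OF lives_forever])

lemma flow_0: "z \<in> unit_disc \<Longrightarrow> flow 0 z = z"
  by (rule livesD(2)[OF lives_forever zero_less_one])

lemma
  assumes z: "z \<in> unit_disc" and t: "0 \<le> t"
  shows flow_in_disc: "flow t z \<in> unit_disc"
    and multiplier_eq: "multiplier t z = exp (integral {0..t} (\<lambda>s. g (flow s z)))"
    and weighted_composition: "f \<in> X \<Longrightarrow> S t f z = multiplier t z * f (flow t z)"
  using livesD(3-5)[OF lives_forever[OF z], of "t + 1" t] t by auto

text \<open>
  Both laws are read off from the semigroup law, applied to the functions 1 and \<open>z\<close>.
\<close>

lemma cocycle_law:
  assumes "z \<in> unit_disc" "0 \<le> t" "0 \<le> s"
  shows "multiplier (t + s) z = multiplier s z * multiplier t (flow s z)"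
    and "flow (t + s) z = flow t (flow s z)"
proof -
  have law: "S (t + s) f z = multiplier s z * (multiplier t (flow s z) * f (flow t (flow s z)))" if "f \<in> X" for f
    using S_S[of s t f] weighted_composition[of z s "S t f"] weighted_composition[of "flow s z" t f]
      S_mem[of t f] flow_in_disc[of z s] that assms by (simp add: add.commute)
  have disc: "flow s z \<in> unit_disc" "flow t (flow s z) \<in> unit_disc" "flow (t + s) z \<in> unit_disc"
    using flow_in_disc[OF assms(1,3)] flow_in_disc[OF flow_in_disc[OF assms(1,3)] assms(2)]
      flow_in_disc[OF assms(1), of "t + s"] assms(2,3) by simp_all
  show m: "multiplier (t + s) z = multiplier s z * multiplier t (flow s z)"
    using law[OF disc_power_mem, of 0] disc by (simp add: multiplier_def disc_power_apply)
  have nz: "multiplier (t + s) z \<noteq> 0" using multiplier_eq[of z "t + s"] assms by simp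
  have "multiplier (t + s) z * flow (t + s) z = multiplier (t + s) z * flow t (flow s z)"
    using law[OF disc_power_mem, of 1] weighted_composition[OF assms(1) _ disc_power_mem, of "t + s" 1] disc assms m
    by (auto simp: disc_power_apply mult.assoc)
  then show "flow (t + s) z = flow t (flow s z)" using nz by simp
qed

lemma flow_holomorphic: "0 \<le> t \<Longrightarrow> flow t holomorphic_on unit_disc"
  unfolding flow_def using multiplier_eq[of _ t]
  by (intro holomorphic_on_divide holomorphic S_mem disc_power_mem) (auto simp: multiplier_def)

lemma flow_continuous_time:
  assumes "z \<in> unit_disc"
  shows "continuous_on {0..} (\<lambda>t. flow t z)"
proof -
  have c: "continuous_on {0..} (\<lambda>t. S t f z)" if "f \<in> X" for f
  proof -
    have "continuous_on {0..} (\<lambda>t. (\<lambda>(t, z). S t f z) (t, z))"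
      by (rule continuous_on_compose2[OF orbit_jointly_continuous[OF that]])
         (use assms in \<open>auto intro!: continuous_intros\<close>)
    then show ?thesis by simp
  qed
  show ?thesis
    unfolding flow_def using multiplier_eq[OF assms]
    by (intro continuous_on_divide c disc_power_mem) (auto simp: multiplier_def)
qed

lemma holomorphic_flow: "holomorphic_flow flow"
  unfolding holomorphic_flow_def
  using flow_holomorphic flow_in_disc flow_0 cocycle_law(2) flow_continuous_time
  by (auto simp: continuous_on_def)

lemma infinitesimal_generator: "infinitesimal_generator flow G"
  unfolding infinitesimal_generator_def
proof
  fix z assume z: "z \<in> unit_disc"
  have "((\<lambda>t. flow t z) has_vector_derivative G (flow 0 z)) (at 0 within {0..1})"
    using flow_solution[OF z, of 1] by (simp add: ode_solution_def)
  then have "((\<lambda>t. (1 / norm (t - 0)) *\<^sub>R (flow t z - (flow 0 z + (t - 0) *\<^sub>R G (flow 0 z)))) \<longlongrightarrow> 0) (at_right 0)"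
    unfolding has_vector_derivative_def has_derivative_within by (simp add: at_within_Icc_at_right)
  moreover have "eventually (\<lambda>t. (1 / norm (t - 0)) *\<^sub>R (flow t z - (flow 0 z + (t - 0) *\<^sub>R G (flow 0 z)))
      = (flow t z - z) / complex_of_real t - G z) (at_right 0)"
    using eventually_at_right_less[of 0]
    by eventually_elim (simp add: flow_0[OF z] scaleR_conv_of_real field_simps)
  ultimately have "((\<lambda>t. (flow t z - z) / complex_of_real t - G z) \<longlongrightarrow> 0) (at_right 0)"
    by (rule Lim_transform_eventually)
  then show "((\<lambda>t. (flow t z - z) / complex_of_real t) \<longlongrightarrow> G z) (at_right 0)"
    by (simp add: Lim_null[symmetric])
qed

lemma multiplier_derivative:
  assumes z: "z \<in> unit_disc"
  shows "((\<lambda>t. multiplier t z) has_vector_derivative g z) (at_right 0)"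
proof -
  have "continuous_on {0..1} (\<lambda>s. g (flow s z))"
    by (rule continuous_on_compose2[OF holomorphic_on_imp_continuous_on[OF g]
          continuous_on_subset[OF flow_continuous_time[OF z]]]) (use flow_in_disc[OF z] in auto)
  then have "((\<lambda>t. integral {0..t} (\<lambda>s. g (flow s z))) has_vector_derivative g z) (at 0 within {0..1})"
    using integral_has_vector_derivative[of 0 1 "\<lambda>s. g (flow s z)" 0] flow_0[OF z] by simp
  from field_vector_diff_chain_within[OF this DERIV_subset[OF DERIV_exp subset_UNIV]]
  have "((\<lambda>t. exp (integral {0..t} (\<lambda>s. g (flow s z)))) has_vector_derivative g z) (at 0 within {0..1})"
    by (simp add: o_def)
  then have "((\<lambda>t. multiplier t z) has_vector_derivative g z) (at 0 within {0..1})"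
    by (rule has_vector_derivative_transform[rotated 2]) (use multiplier_eq[OF z] in auto)
  then show ?thesis by (simp add: at_within_Icc_at_right)
qed

lemma cocycle: "cocycle flow multiplier"
  unfolding cocycle_def
proof (intro conjI)
  show "continuous_on ({0..} \<times> unit_disc) (\<lambda>(t, z). multiplier t z)"
    unfolding multiplier_def by (rule orbit_jointly_continuous[OF disc_power_mem])
  show "\<forall>t\<ge>0. multiplier t holomorphic_on unit_disc"
    unfolding multiplier_def[abs_def] by (intro allI impI holomorphic S_mem disc_power_mem)
  show "\<forall>z\<in>unit_disc. multiplier 0 z = 1"
    using multiplier_eq by simp
  show "\<forall>t\<ge>0. \<forall>s\<ge>0. \<forall>z\<in>unit_disc. multiplier (t + s) z = multiplier s z * multiplier t (flow s z)"
    using cocycle_law(1) by blast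
qed

end

section \<open>Semigroups generated by first order operators\<close>

theorem theorem3p1:
  fixes X :: "(complex \<Rightarrow> complex) set"
    and N :: "(complex \<Rightarrow> complex) \<Rightarrow> real"
    and G g :: "complex \<Rightarrow> complex"
    and S :: "real \<Rightarrow> (complex \<Rightarrow> complex) \<Rightarrow> complex \<Rightarrow> complex"
  assumes "banach_space_of_analytic_functions X N"
    and "continuous_map Hol_closed_disc_topology (norm_topology X N) (\<lambda>f. f)"
    and "continuous_map (norm_topology X N) (Hol_topology unit_disc) (\<lambda>f. f)"
    and "G holomorphic_on unit_disc" and "g holomorphic_on unit_disc"
    and "C0_semigroup X N S"
    and "generator_domain X N S = {f \<in> X. first_order_expr G g f \<in> X}"
    and "\<And>f. f \<in> generator_domain X N S \<Longrightarrow> generator X N S f = first_order_expr G g f"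
  shows "\<exists>\<phi> m. holomorphic_flow \<phi> \<and> infinitesimal_generator \<phi> G \<and> cocycle \<phi> m \<and>
    (\<forall>z\<in>unit_disc. ((\<lambda>t. m t z) has_vector_derivative g z) (at_right 0)) \<and>
    (\<forall>t\<ge>0. \<forall>z\<in>unit_disc. m t z = exp (integral {0..t} (\<lambda>s. g (\<phi> s z)))) \<and>
    (\<forall>t\<ge>0. \<forall>z\<in>unit_disc. \<forall>f\<in>X. S t f z = m t z * f (\<phi> t z))"
proof -
  interpret weighted_generator X N S G g
    using assms by unfold_locales
  show ?thesis
    using holomorphic_flow infinitesimal_generator cocycle multiplier_derivative multiplier_eq weighted_composition
    by (intro exI[of _ flow] exI[of _ multiplier]) blast
qed

end
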